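(* Let $n_0,\ldots,n_r$ be positive integers, $V=\bigcup_{i=0}^rV_i$ with $V_i=\{i^1,\ldots,i^{n_i}\}$, and $\mathcal{S}\subset\mathbb{Z}$ with $\min\mathcal{S}=m$ and $\max\mathcal{S}=1$. There exists a bijection $\Phi$ between $\mathcal{S}$-functions $f:V\setminus\{0^1\}\to V$ satisfying (F): $f(i^1)=(i-1)^1$ for $1\le i\le r$, and marked $\mathcal{S}$-trees $(T,r^q)$ on the vertex set $V$, rooted at $0^1$, satisfying (T): for every $i\in\{1,\ldots,r\}$, on the path going from $r^q$ to $0^1$, the first vertex belonging to $V_{i-1}$ is (immediately) preceded by $i^1$. Moreover, $\Phi$ (a) preserves the out-type of every vertex; (b) preserves, for all $i$ and $\mathbf{c}$, the number of vertices of in-type $(i;\mathbf{c})$; (c) preserves the complete type of each vertex if $0\notin\mathcal{S}$.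
   Context: A vertex $i^k\in V_i$ has abscissa $a(i^k)=i$. A partial function $f$ on $V$ is viewed as a digraph with an arc $v\to f(v)$ for each $v$ where $f$ is defined. It is an $\mathcal{S}$-function if for every $v=i^k$ where $f(v)$ is defined, $f(v)\in\bigcup_{s\in\mathcal{S}}V_{i-s}$. The type of a vertex $v$ is $(i;s;c^m,\ldots,c^1)$ where $i=a(v)$, $i-s$ is the abscissa of $f(v)$ ($s=\varepsilon$ if $f(v)$ is undefined), and $c^k$ is the number of preimages of $v$ at abscissa $i+k$ ($m\le k\le1$); its out-type is $(i;s)$ and its in-type is $(i;\mathbf{c})$ with $\mathbf{c}=(c^m,\ldots,c^1)$. An $\mathcal{S}$-tree is a rooted tree on vertex set $V$ in which the parent of every non-root vertex of $V_i$ lies in $\bigcup_{s\in\mathcal{S}}V_{i-s}$; orienting edges towards the root it is viewed as an $\mathcal{S}$-function (parent map), which defines types, in-types and out-types of its vertices. A marked $\mathcal{S}$-tree is a pair $(T,r^q)$ with $T$ an $\mathcal{S}$-tree and $r^q\in V_r$ a marked vertex. *)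

theory Defs
  imports Main
begin

section \<open>Vertices\<close>

text \<open>The vertex \<open>i\<^sup>k\<close> is encoded as the pair \<open>(i, k)\<close>. Layers are indexed by integers, so
  that \<open>V\<^sub>j\<close> is empty for \<open>j < 0\<close> and for \<open>j > r\<close>.\<close>

type_synonym vertex = "nat \<times> nat"

definition abscissa :: "vertex \<Rightarrow> int" where
  "abscissa v = int (fst v)"

definition vertices :: "(nat \<Rightarrow> nat) \<Rightarrow> nat \<Rightarrow> vertex set" where
  "vertices n r = (SIGMA i:{0..r}. {1..n i})"

definition layer :: "(nat \<Rightarrow> nat) \<Rightarrow> nat \<Rightarrow> int \<Rightarrow> vertex set" where
  "layer n r j = {v \<in> vertices n r. abscissa v = j}"


section \<open>Partial functions on the vertex set\<close>

definition S_function ::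
    "(nat \<Rightarrow> nat) \<Rightarrow> nat \<Rightarrow> int set \<Rightarrow> (vertex \<rightharpoonup> vertex) \<Rightarrow> bool" where
  "S_function n r S f \<longleftrightarrow>
     dom f \<subseteq> vertices n r \<and>
     (\<forall>v w. f v = Some w \<longrightarrow> w \<in> (\<Union>s\<in>S. layer n r (abscissa v - s)))"

text \<open>The empty step \<open>\<epsilon>\<close> is \<^const>\<open>None\<close>; \<open>(c\<^sup>m, \<dots>, c\<^sup>1)\<close> is a list of length \<open>2 - m\<close>,
  in this order.\<close>

definition out_step :: "(vertex \<rightharpoonup> vertex) \<Rightarrow> vertex \<Rightarrow> int option" where
  "out_step f v = map_option (\<lambda>w. abscissa v - abscissa w) (f v)"

definition in_degrees :: "int \<Rightarrow> (vertex \<rightharpoonup> vertex) \<Rightarrow> vertex \<Rightarrow> nat list" where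
  "in_degrees m f v =
     map (\<lambda>k. card {u. f u = Some v \<and> abscissa u = abscissa v + k}) [m..1]"

definition out_type :: "(vertex \<rightharpoonup> vertex) \<Rightarrow> vertex \<Rightarrow> int \<times> int option" where
  "out_type f v = (abscissa v, out_step f v)"

definition in_type :: "int \<Rightarrow> (vertex \<rightharpoonup> vertex) \<Rightarrow> vertex \<Rightarrow> int \<times> nat list" where
  "in_type m f v = (abscissa v, in_degrees m f v)"

definition vertex_type ::
    "int \<Rightarrow> (vertex \<rightharpoonup> vertex) \<Rightarrow> vertex \<Rightarrow> int \<times> int option \<times> nat list" where
  "vertex_type m f v = (abscissa v, out_step f v, in_degrees m f v)"


section \<open>Rooted trees\<close>

text \<open>Trees are undirected simple graphs, given by a vertex set and a set of two-element edges.\<close>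

definition is_path :: "'a set \<Rightarrow> 'a set set \<Rightarrow> 'a \<Rightarrow> 'a list \<Rightarrow> 'a \<Rightarrow> bool" where
  "is_path V E u p v \<longleftrightarrow>
     p \<noteq> [] \<and> hd p = u \<and> last p = v \<and> set p \<subseteq> V \<and> distinct p \<and>
     successively (\<lambda>x y. {x, y} \<in> E) p"

definition is_cycle :: "'a set set \<Rightarrow> 'a list \<Rightarrow> bool" where
  "is_cycle E p \<longleftrightarrow>
     3 \<le> length p \<and> distinct p \<and> successively (\<lambda>x y. {x, y} \<in> E) p \<and> {last p, hd p} \<in> E"

definition is_tree :: "'a set \<Rightarrow> 'a set set \<Rightarrow> bool" where
  "is_tree V E \<longleftrightarrow>
     V \<noteq> {} \<and>
     E \<subseteq> {e. e \<subseteq> V \<and> card e = 2} \<and>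
     (\<forall>u\<in>V. \<forall>v\<in>V. \<exists>p. is_path V E u p v) \<and>
     (\<nexists>p. is_cycle E p)"

definition tree_path :: "'a set \<Rightarrow> 'a set set \<Rightarrow> 'a \<Rightarrow> 'a \<Rightarrow> 'a list" where
  "tree_path V E u v = (THE p. is_path V E u p v)"

text \<open>The parent map of the tree \<open>E\<close> with root \<open>\<rho>\<close>: the parent of \<open>v\<close> is the vertex following \<open>v\<close>
  on the path from \<open>v\<close> to \<open>\<rho>\<close>.\<close>

definition parent_map :: "'a set \<Rightarrow> 'a set set \<Rightarrow> 'a \<Rightarrow> ('a \<rightharpoonup> 'a)" where
  "parent_map V E \<rho> v = (if v \<in> V - {\<rho>} then Some (tree_path V E v \<rho> ! 1) else None)"

definition S_tree ::
    "(nat \<Rightarrow> nat) \<Rightarrow> nat \<Rightarrow> int set \<Rightarrow> vertex \<Rightarrow> vertex set set \<Rightarrow> bool" where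
  "S_tree n r S \<rho> E \<longleftrightarrow>
     is_tree (vertices n r) E \<and> \<rho> \<in> vertices n r \<and>
     (\<forall>v w. parent_map (vertices n r) E \<rho> v = Some w \<longrightarrow>
        w \<in> (\<Union>s\<in>S. layer n r (abscissa v - s)))"

definition marked_S_tree ::
    "(nat \<Rightarrow> nat) \<Rightarrow> nat \<Rightarrow> int set \<Rightarrow> vertex \<Rightarrow> vertex set set \<times> vertex \<Rightarrow> bool" where
  "marked_S_tree n r S \<rho> = (\<lambda>(E, x). S_tree n r S \<rho> E \<and> x \<in> layer n r (int r))"


section \<open>The conditions (F) and (T)\<close>

definition condition_F :: "nat \<Rightarrow> (vertex \<rightharpoonup> vertex) \<Rightarrow> bool" where
  "condition_F r f \<longleftrightarrow> (\<forall>i\<in>{1..r}. f (i, 1) = Some (i - 1, 1))"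

text \<open>In the decomposition below, \<open>w\<close> is the first vertex of the path lying in \<open>V\<^bsub>i-1\<^esub>\<close>.\<close>

definition condition_T ::
    "(nat \<Rightarrow> nat) \<Rightarrow> nat \<Rightarrow> vertex \<Rightarrow> vertex set set \<times> vertex \<Rightarrow> bool" where
  "condition_T n r \<rho> = (\<lambda>(E, x). \<forall>i\<in>{1..r}. \<exists>xs w ys.
     tree_path (vertices n r) E x \<rho> = xs @ [(i, 1), w] @ ys \<and>
     w \<in> layer n r (int i - 1) \<and>
     (\<forall>y \<in> set (xs @ [(i, 1)]). y \<notin> layer n r (int i - 1)))"

end

theory Submission
  imports Defs "HOL-Combinatorics.Permutations"
begin

text \<open>
  Add an arc from \<open>0\<^sup>1\<close> to \<open>r\<^sup>1\<close> to a function satisfying (F), and an arc from the root \<open>0\<^sup>1\<close> to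
  the marked vertex of a tree. Both become total maps in which, for every \<open>i\<close>, the arc leaving
  \<open>(i + 1)\<^sup>1\<close> (or \<open>0\<^sup>1\<close> if \<open>i = r\<close>) enters level \<open>i\<close>. Steps decrease the abscissa by at most 1, so in
  the tree this arc starts an excursion in the levels \<open>\<ge> i\<close> that ends at \<open>i\<^sup>1\<close>; in the function the
  excursion is trivial, but there may be cycles of minimal level \<open>i\<close>. Let \<open>U\<^sub>i\<close> be the set of the
  level-\<open>i\<close> vertices of the excursion and of these cycles (\<open>entries h i\<close>). After gluing the end \<open>i\<^sup>1\<close> of the excursion
  to its start, the first return map is a permutation of \<open>U\<^sub>i\<close>. Functions with (F) are exactly the maps
  whose return permutations all fix \<open>i\<^sup>1\<close>, marked trees with (T) exactly those whose return
  permutations are all cyclic, and there are \<open>(|U\<^sub>i| - 1)!\<close> permutations of \<open>U\<^sub>i\<close> of each kind.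
  Any return permutations can be realised by permuting the heads of the arcs entering the
  \<open>U\<^sub>i\<close>, which changes neither the sets \<open>U\<^sub>i\<close> nor any out-type. If all arcs are moved, vertices just
  exchange their in-types. If \<open>0 \<notin> S\<close>, one moves only the arcs lying on excursions and cycles:
  each vertex of \<open>U\<^sub>i\<close> is entered by one such arc, from level \<open>i + 1\<close>, before and after.
\<close>

section \<open>Trees and parent maps\<close>

lemma is_path_Cons_Cons:
  "is_path V E u (x # y # p) v \<longleftrightarrow>
     x = u \<and> u \<in> V \<and> u \<notin> set (y # p) \<and> {u, y} \<in> E \<and> is_path V E y (y # p) v"
  unfolding is_path_def by auto

lemma is_path_singleton: "is_path V E u [x] v \<longleftrightarrow> x = u \<and> u = v \<and> u \<in> V"
  unfolding is_path_def by auto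

lemma is_path_hd_last:
  assumes "is_path V E u p v"
  shows "u \<in> set p" "v \<in> set p" "p = u # tl p"
  using assms unfolding is_path_def by (auto intro: hd_in_set last_in_set simp: neq_Nil_conv)

text \<open>Following \<open>p\<close> only up to its first vertex on \<open>q\<close>, and from
  there \<open>q\<close> backwards, creates no repetition. The inclusion of vertex sets later keeps
  a given vertex off the merged path.\<close>

lemma is_path_merge:
  assumes p: "is_path V E u p x" and q: "is_path V E v q x"
  shows "\<exists>c. is_path V E u c v \<and> set c \<subseteq> set p \<union> set q"
proof -
  have "\<exists>w\<in>set p. w \<in> set q"
    using is_path_hd_last(2)[OF p] is_path_hd_last(2)[OF q] by blast
  then obtain A w B where A: "p = A @ w # B" "w \<in> set q" "\<forall>y\<in>set A. y \<notin> set q"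
    using split_list_first_prop[of p "\<lambda>w. w \<in> set q"] by blast
  obtain C D where C: "q = C @ w # D"
    using split_list[OF A(2)] by blast
  have sym: "(\<lambda>x y. {y, x} \<in> E) = (\<lambda>x y. {x, y} \<in> E)"
    by (simp add: insert_commute)
  have sC: "successively (\<lambda>x y. {x, y} \<in> E) (C @ [w])"
    using q unfolding C is_path_def by (auto simp: successively_append_iff)
  then have "successively (\<lambda>x y. {x, y} \<in> E) (rev (C @ [w]))"
    unfolding successively_rev by (subst sym)
  moreover have "successively (\<lambda>x y. {x, y} \<in> E) (A @ [w])"
    using p unfolding A is_path_def by (auto simp: successively_append_iff)
  ultimately have "successively (\<lambda>x y. {x, y} \<in> E) (A @ w # rev C)"
    by (auto simp: successively_append_iff)
  moreover have "hd (A @ w # rev C) = u" "last (A @ w # rev C) = v"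
    using p q unfolding A C is_path_def by (simp_all add: hd_append last_rev split: if_splits)
  moreover have "distinct (A @ w # rev C)" "set (A @ w # rev C) \<subseteq> V"
    using p q A(3) unfolding A(1) C is_path_def by auto
  ultimately have "is_path V E u (A @ w # rev C) v"
    unfolding is_path_def by simp
  then show ?thesis
    unfolding A(1) C by (intro exI[of _ "A @ w # rev C"]) auto
qed

text \<open>If two such paths had different second vertices \<open>y\<close> and \<open>z\<close>,
  their tails would merge into a path from \<open>y\<close> to \<open>z\<close> missing
  \<open>u\<close>, and \<open>u\<close> would close it to a cycle.\<close>

lemma acyclic_path_unique:
  assumes acyclic: "\<nexists>c. is_cycle E c"
  shows "is_path V E u p v \<Longrightarrow> is_path V E u q v \<Longrightarrow> p = q"
proof (induction p arbitrary: u q)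
  case Nil
  then show ?case by (simp add: is_path_def)
next
  case (Cons u' p)
  obtain q' where q: "q = u # q'" and u': "u' = u"
    using is_path_hd_last(3)[OF Cons.prems(2)] is_path_hd_last(3)[OF Cons.prems(1)] by auto
  show ?case
  proof (cases "p = [] \<or> q' = []")
    case True
    then show ?thesis
      using Cons.prems last_in_set[of p] last_in_set[of q'] unfolding q u' is_path_def
      by (cases "p = []"; cases "q' = []") simp_all
  next
    case False
    then obtain y p'' z q'' where p: "p = y # p''" and q': "q' = z # q''"
      by (auto simp: neq_Nil_conv)
    have y: "u \<notin> set p" "{u, y} \<in> E" "is_path V E y p v"
      using Cons.prems(1) unfolding p is_path_Cons_Cons by auto
    have z: "u \<notin> set q'" "{u, z} \<in> E" "is_path V E z q' v"
      using Cons.prems(2) unfolding q q' is_path_Cons_Cons by auto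
    have "y = z"
    proof (rule ccontr)
      assume "y \<noteq> z"
      obtain c where c: "is_path V E y c z" "set c \<subseteq> set p \<union> set q'"
        using is_path_merge[OF y(3) z(3)] by blast
      obtain c' where c': "c = y # c'"
        using is_path_hd_last(3)[OF c(1)] by blast
      have "c' \<noteq> []"
        using c(1) \<open>y \<noteq> z\<close> unfolding c' by (auto simp: is_path_singleton)
      then have "3 \<le> length (u # c)"
        unfolding c' by (cases c') auto
      moreover have "u \<notin> set c"
        using c(2) y(1) z(1) by blast
      ultimately have "is_cycle E (u # c)"
        using c(1) y(2) z(2) unfolding is_cycle_def is_path_def c' by (auto simp: insert_commute)
      then show False
        using acyclic by blast
    qed
    then show ?thesis
      using Cons.IH[OF y(3), of q'] z(3) unfolding q u' by simp
  qed
qed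

lemma tree_path_eq:
  assumes "is_tree V E" "is_path V E u p v"
  shows "tree_path V E u v = p"
proof -
  have "\<nexists>c. is_cycle E c"
    using assms(1) unfolding is_tree_def by blast
  then show ?thesis
    unfolding tree_path_def by (intro the_equality acyclic_path_unique[OF _ _ assms(2)] assms(2))
qed

lemma tree_path_step:
  assumes T: "is_tree V E" and \<rho>: "\<rho> \<in> V" and v: "v \<in> V" "v \<noteq> \<rho>"
  obtains w where "parent_map V E \<rho> v = Some w" "w \<in> V" "{v, w} \<in> E"
    "tree_path V E v \<rho> = v # tree_path V E w \<rho>"
proof -
  obtain p where p: "is_path V E v p \<rho>"
    using T \<rho> v unfolding is_tree_def by blast
  then obtain w p' where eq: "p = v # w # p'"
    using v(2) is_path_hd_last(3)[OF p] by (metis is_path_singleton neq_Nil_conv)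
  have *: "is_path V E w (w # p') \<rho>" "{v, w} \<in> E"
    using p unfolding eq is_path_Cons_Cons by auto
  then have "w \<in> V"
    unfolding is_path_def by simp
  moreover have "tree_path V E v \<rho> = v # tree_path V E w \<rho>"
    using tree_path_eq[OF T p] tree_path_eq[OF T *(1)] eq by simp
  moreover have "parent_map V E \<rho> v = Some w"
    using tree_path_eq[OF T p] v unfolding parent_map_def eq by simp
  ultimately show thesis
    using that * by blast
qed

text \<open>For an edge \<open>{a, b}\<close>, either \<open>b\<close> lies on the path from
  \<open>a\<close> to the root, and the edge gives a shortcut that uniqueness identifies with this
  path; or prepending \<open>b\<close> gives the path from \<open>b\<close>, whose next vertex is
  \<open>a\<close>.\<close>

lemma tree_edges_eq_parent_edges:
  assumes T: "is_tree V E" and \<rho>: "\<rho> \<in> V"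
  shows "E = {{v, w} |v w. parent_map V E \<rho> v = Some w}"
proof
  show "{{v, w} |v w. parent_map V E \<rho> v = Some w} \<subseteq> E"
  proof clarify
    fix v w assume *: "parent_map V E \<rho> v = Some w"
    then have "v \<in> V" "v \<noteq> \<rho>"
      by (auto simp: parent_map_def split: if_splits)
    then show "{v, w} \<in> E"
      using tree_path_step[OF T \<rho>] * by (metis option.inject)
  qed
next
  have path: "is_path V E v (tree_path V E v \<rho>) \<rho>" if "v \<in> V" for v
    using that T \<rho> tree_path_eq[OF T] unfolding is_tree_def by metis
  have parent: "parent_map V E \<rho> a = Some b" if "is_path V E a (a # b # p) \<rho>" for a b p
  proof -
    have "a \<in> V" "a \<noteq> \<rho>"
      using that unfolding is_path_def by (auto split: if_splits)
    then show ?thesis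
      using tree_path_eq[OF T that] unfolding parent_map_def by simp
  qed
  show "E \<subseteq> {{v, w} |v w. parent_map V E \<rho> v = Some w}"
  proof
    fix e assume e: "e \<in> E"
    then have "e \<subseteq> V" "card e = 2"
      using T unfolding is_tree_def by auto
    then obtain a b where ab: "e = {a, b}" "a \<noteq> b" "a \<in> V" "b \<in> V"
      by (auto simp: card_2_iff)
    define p where "p = tree_path V E a \<rho>"
    have p: "is_path V E a p \<rho>"
      using path ab unfolding p_def by blast
    show "e \<in> {{v, w} |v w. parent_map V E \<rho> v = Some w}"
    proof (cases "b \<in> set p")
      case True
      then obtain A B where A: "p = A @ b # B"
        by (meson split_list)
      moreover have "p = a # tl p"
        using is_path_hd_last(3)[OF p] .
      ultimately obtain A' where A': "A = a # A'"
        using ab(2) by (cases A) auto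
      have "is_path V E a (a # b # B) \<rho>"
        using p e ab unfolding A A' is_path_def by (auto simp: successively_append_iff successively_Cons)
      then have "parent_map V E \<rho> a = Some b"
        by (rule parent)
      then show ?thesis
        using ab by blast
    next
      case False
      have pa: "p = a # tl p"
        using is_path_hd_last(3)[OF p] .
      have "is_path V E b (b # a # tl p) \<rho>"
        using p False e ab pa unfolding is_path_Cons_Cons by (metis insert_commute)
      then have "parent_map V E \<rho> b = Some a"
        by (rule parent)
      then show ?thesis
        using ab by (auto simp: insert_commute)
    qed
  qed
qed

section \<open>Trees built from maps that lead to a root\<close>

definition map_edges :: "'a set \<Rightarrow> 'a \<Rightarrow> ('a \<Rightarrow> 'a) \<Rightarrow> 'a set set" where
  "map_edges V \<rho> g = (\<lambda>v. {v, g v}) ` (V - {\<rho>})"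

text \<open>The value \<open>g \<rho>\<close> is left free, since it will later store the marked
  vertex.\<close>

locale rooted_map =
  fixes V :: "'a set" and \<rho> :: 'a and g :: "'a \<Rightarrow> 'a"
  assumes root: "\<rho> \<in> V"
    and closed: "v \<in> V \<Longrightarrow> v \<noteq> \<rho> \<Longrightarrow> g v \<in> V"
    and reach: "v \<in> V \<Longrightarrow> \<exists>k. (g ^^ k) v = \<rho>"
begin

definition depth :: "'a \<Rightarrow> nat" where
  "depth v = (LEAST k. (g ^^ k) v = \<rho>)"

lemma depth_Suc:
  assumes "v \<in> V" "v \<noteq> \<rho>"
  shows "depth v = Suc (depth (g v))"
proof -
  obtain k where "(g ^^ k) v = \<rho>"
    using reach assms(1) by blast
  then have "depth v = Suc (LEAST k. (g ^^ Suc k) v = \<rho>)"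
    unfolding depth_def using assms(2) by (intro Least_Suc) auto
  then show ?thesis
    unfolding depth_def by (simp add: funpow_swap1)
qed

definition walk :: "'a \<Rightarrow> 'a list" where
  "walk v = map (\<lambda>k. (g ^^ k) v) [0..<Suc (depth v)]"

lemma walk_root: "walk \<rho> = [\<rho>]"
proof -
  have "depth \<rho> = 0"
    unfolding depth_def by (rule Least_equality) auto
  then show ?thesis
    unfolding walk_def by simp
qed

lemma walk_Cons:
  assumes "v \<in> V" "v \<noteq> \<rho>"
  shows "walk v = v # walk (g v)"
proof -
  have "[0..<Suc (depth v)] = 0 # map Suc [0..<Suc (depth (g v))]"
    unfolding depth_Suc[OF assms] map_Suc_upt by (rule upt_conv_Cons) simp
  then show ?thesis
    unfolding walk_def by (simp add: funpow_swap1 del: upt_Suc)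
qed

text \<open>Depth drops by one along each arc. The second conjunct carries this through the
  induction and keeps \<open>v\<close> off the walk that starts at \<open>g v\<close>.\<close>

lemma walk_is_path:
  "v \<in> V \<Longrightarrow> is_path V (map_edges V \<rho> g) v (walk v) \<rho> \<and> (\<forall>x\<in>set (walk v). depth x \<le> depth v)"
proof (induction "depth v" arbitrary: v)
  case 0
  then have "v = \<rho>"
    using depth_Suc by force
  then show ?case
    using root by (simp add: walk_root is_path_singleton)
next
  case (Suc d)
  show ?case
  proof (cases "v = \<rho>")
    case True
    then show ?thesis
      using root by (simp add: walk_root is_path_singleton)
  next
    case False
    have IH: "is_path V (map_edges V \<rho> g) (g v) (walk (g v)) \<rho>"
      "\<forall>x\<in>set (walk (g v)). depth x \<le> depth (g v)"
      using Suc.hyps closed depth_Suc[OF Suc.prems False] Suc.prems False by auto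
    have "v \<notin> set (walk (g v))"
      using IH(2) depth_Suc[OF Suc.prems False] by force
    moreover have "walk (g v) = g v # tl (walk (g v))"
      using is_path_hd_last(3)[OF IH(1)] .
    moreover have "{v, g v} \<in> map_edges V \<rho> g"
      using Suc.prems False unfolding map_edges_def by blast
    ultimately have "is_path V (map_edges V \<rho> g) v (walk v) \<rho>"
      using IH(1) Suc.prems walk_Cons[OF Suc.prems False] by (metis is_path_Cons_Cons)
    then show ?thesis
      using IH(2) depth_Suc[OF Suc.prems False] walk_Cons[OF Suc.prems False] by auto
  qed
qed

text \<open>On a cycle, both neighbours of a vertex \<open>x\<close> of maximal depth must equal
  \<open>g x\<close>, because a preimage of \<open>x\<close> would be deeper. In a cycle of length
  at least 3 these neighbours are distinct.\<close>

lemma no_cycle: "\<not> is_cycle (map_edges V \<rho> g) c"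
proof
  assume c: "is_cycle (map_edges V \<rho> g) c"
  define l where "l = length c"
  have l: "3 \<le> l" and dist: "distinct c"
    using c unfolding is_cycle_def l_def by auto
  have adj: "{c ! j, c ! (Suc j mod l)} \<in> map_edges V \<rho> g" if "j < l" for j
  proof (cases "Suc j = l")
    case True
    have "c \<noteq> []" using l l_def by auto
    then have "last c = c ! j" "hd c = c ! 0"
      using True unfolding l_def by (auto simp: last_conv_nth hd_conv_nth dest: sym)
    then show ?thesis
      using c True unfolding is_cycle_def by simp
  next
    case False
    then show ?thesis
      using c that unfolding is_cycle_def l_def by (auto simp: successively_conv_nth)
  qed
  have "finite (depth ` set c)" "depth ` set c \<noteq> {}"
    using l l_def by auto
  then obtain x where x: "x \<in> set c" "\<And>y. y \<in> set c \<Longrightarrow> depth y \<le> depth x"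
    by (metis (no_types, lifting) Max_ge Max_in imageE imageI)
  have parent: "y = g x" if xy: "{x, y} \<in> map_edges V \<rho> g" "y \<in> set c" for y
  proof -
    obtain v where "v \<in> V - {\<rho>}" and v3: "{x, y} = {v, g v}"
      using xy(1) unfolding map_edges_def by (rule imageE)
    then have v: "v \<in> V" "v \<noteq> \<rho>" by auto
    show ?thesis
    proof (cases "x = v")
      case True
      then show ?thesis
        using v3 by (auto simp: doubleton_eq_iff)
    next
      case False
      then have "v = y" "g v = x"
        using v3 by (auto simp: doubleton_eq_iff)
      then show ?thesis
        using x(2)[OF xy(2)] depth_Suc[OF v] by simp
    qed
  qed
  obtain j where j: "j < l" "c ! j = x"
    using x(1) unfolding l_def by (auto simp: in_set_conv_nth)
  \<comment> \<open>The cyclic predecessor of the index \<open>j\<close>.\<close>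
  define j' where "j' = (if j = 0 then l - 1 else j - 1)"
  have j': "j' < l" "Suc j' mod l = j"
    using j l unfolding j'_def by auto
  have "Suc j mod l < l"
    using l by simp
  then have "c ! (Suc j mod l) = g x" "c ! j' = g x"
    using parent adj[OF j(1)] adj[OF j'(1)] j j' unfolding l_def
    by (auto simp: insert_commute)
  then have "Suc j mod l = j'"
    using dist j'(1) \<open>Suc j mod l < l\<close> unfolding l_def by (metis nth_eq_iff_index_eq)
  moreover have "Suc j mod l \<noteq> j'"
    using j(1) l unfolding j'_def by (cases "Suc j = l") auto
  ultimately show False by simp
qed

lemma map_edges_is_tree: "is_tree V (map_edges V \<rho> g)"
proof -
  have "g v \<noteq> v" if "v \<in> V" "v \<noteq> \<rho>" for v
    using depth_Suc[OF that] by force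
  then have "map_edges V \<rho> g \<subseteq> {e. e \<subseteq> V \<and> card e = 2}"
    using closed unfolding map_edges_def by (auto simp: card_2_iff)
  moreover have "\<exists>p. is_path V (map_edges V \<rho> g) u p v" if "u \<in> V" "v \<in> V" for u v
    using is_path_merge walk_is_path that by metis
  ultimately show ?thesis
    unfolding is_tree_def using root no_cycle by blast
qed

lemma tree_path_eq_walk: "v \<in> V \<Longrightarrow> tree_path V (map_edges V \<rho> g) v \<rho> = walk v"
  using tree_path_eq[OF map_edges_is_tree] walk_is_path by blast

lemma parent_map_map_edges:
  "parent_map V (map_edges V \<rho> g) \<rho> = (\<lambda>v. if v \<in> V - {\<rho>} then Some (g v) else None)"
proof
  fix v
  show "parent_map V (map_edges V \<rho> g) \<rho> v = (if v \<in> V - {\<rho>} then Some (g v) else None)"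
  proof (cases "v \<in> V - {\<rho>}")
    case True
    then have "walk v = v # walk (g v)" "walk (g v) = g v # tl (walk (g v))"
      using walk_Cons walk_is_path[of "g v"] closed is_path_hd_last(3) by auto
    then have "walk v ! 1 = g v"
      by (metis One_nat_def nth_Cons_0 nth_Cons_Suc)
    then show ?thesis
      using True tree_path_eq_walk unfolding parent_map_def by simp
  qed (auto simp: parent_map_def)
qed

end

text \<open>Tree paths lose one vertex per parent step, so every total extension of the parent map
  reaches the root. Together with \<open>parent_map_map_edges\<close> this makes
  \<open>map_edges\<close> and \<open>parent_map\<close> mutually inverse.\<close>

lemma tree_parent_rooted_map:
  assumes T: "is_tree V E" and \<rho>: "\<rho> \<in> V"
    and g: "\<And>v w. parent_map V E \<rho> v = Some w \<Longrightarrow> g v = w"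
  shows "rooted_map V \<rho> g" and "map_edges V \<rho> g = E"
proof -
  have dom: "parent_map V E \<rho> v = (if v \<in> V - {\<rho>} then Some (g v) else None)" for v
    using g[of v] unfolding parent_map_def by auto
  have "\<exists>k. (g ^^ k) v = \<rho>" if "v \<in> V" for v
    using that
  proof (induction "length (tree_path V E v \<rho>)" arbitrary: v rule: less_induct)
    case less
    show ?case
    proof (cases "v = \<rho>")
      case True
      then have "(g ^^ 0) v = \<rho>" by simp
      then show ?thesis by blast
    next
      case False
      obtain w where w: "parent_map V E \<rho> v = Some w" "w \<in> V"
        "tree_path V E v \<rho> = v # tree_path V E w \<rho>"
        using tree_path_step[OF T \<rho> less.prems False] by blast
      then obtain k where "(g ^^ k) w = \<rho>"
        using less.hyps[of w] by auto
      then have "(g ^^ Suc k) v = \<rho>"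
        using g[OF w(1)] by (simp add: funpow_swap1)
      then show ?thesis by blast
    qed
  qed
  moreover have "g v \<in> V" if "v \<in> V" "v \<noteq> \<rho>" for v
    using tree_path_step[OF T \<rho> that] g by metis
  ultimately show "rooted_map V \<rho> g"
    using \<rho> by unfold_locales auto
  have "{{v, w} |v w. parent_map V E \<rho> v = Some w} = map_edges V \<rho> g"
    unfolding map_edges_def dom by (auto split: if_splits)
  then show "map_edges V \<rho> g = E"
    using tree_edges_eq_parent_edges[OF T \<rho>] by simp
qed

section \<open>Cyclic permutations\<close>

text \<open>For a permutation of a finite \<open>U\<close> containing \<open>a\<close> this says
  that \<open>p\<close> is a single cycle on \<open>U\<close>. Phrased as reachability it also makes
  sense for \<open>cut h i\<close>, whose orbits may leave \<open>U\<close>.\<close>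

definition absorbed :: "('a \<Rightarrow> 'a) \<Rightarrow> 'a set \<Rightarrow> 'a \<Rightarrow> bool" where
  "absorbed p U a \<longleftrightarrow> (\<forall>v\<in>U. \<exists>k. (p ^^ k) v = a)"

lemma absorbedI:
  assumes "\<And>v. v \<in> U \<Longrightarrow> (v, a) \<in> {(x, p x) |x. True}\<^sup>*"
  shows "absorbed p U a"
proof -
  have "\<exists>k. (p ^^ k) v = a" if "(v, a) \<in> {(x, p x) |x. True}\<^sup>*" for v
    using that
  proof (induction rule: converse_rtrancl_induct)
    case base
    have "(p ^^ 0) a = a" by simp
    then show ?case by blast
  next
    case (step y z)
    then obtain k where "(p ^^ k) z = a" "z = p y" by blast
    then have "(p ^^ Suc k) y = a" by (simp add: funpow_swap1)
    then show ?case by blast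
  qed
  then show ?thesis
    unfolding absorbed_def using assms by blast
qed

lemma absorbed_reach:
  assumes "absorbed p U a" "v \<in> U"
  shows "(v, a) \<in> {(x, p x) |x. True}\<^sup>*"
proof -
  have "(v, (p ^^ k) v) \<in> {(x, p x) |x. True}\<^sup>*" for k
    by (induction k) (auto intro: rtrancl_into_rtrancl)
  moreover obtain k where "(p ^^ k) v = a"
    using assms unfolding absorbed_def by blast
  ultimately show ?thesis by blast
qed

text \<open>The composition sends \<open>w\<close> to \<open>u\<close> and \<open>u\<close> to
  \<open>p w\<close>: it splices the fixed point \<open>u\<close> into the cycle of \<open>w\<close>
  right after \<open>w\<close> and changes no other arc.\<close>

lemma absorbed_insert:
  assumes w: "w \<in> U" and u: "u \<notin> U" and a: "a \<in> U" and p: "p permutes U"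
  shows "absorbed (p \<circ> transpose u w) (insert u U) a \<longleftrightarrow> absorbed p U a"
proof -
  let ?q = "p \<circ> transpose u w"
  let ?P = "{(x, p x) |x. True}\<^sup>*" and ?Q = "{(x, ?q x) |x. True}\<^sup>*"
  have pu: "p u = u"
    using p u by (simp add: permutes_not_in)
  have qw: "?q w = u" and qu: "?q u = p w"
    using pu by simp_all
  have q: "?q x = p x" if "x \<in> U" "x \<noteq> w" for x
    using that u by (auto simp: transpose_def)
  have inU: "p x \<in> U" if "x \<in> U" for x
    using that p by (simp add: permutes_in_image)
  show ?thesis
  proof
    assume *: "absorbed ?q (insert u U) a"
    \<comment> \<open>Walks are translated back by leaving out \<open>u\<close>, which is
      represented by its successor \<open>p w\<close>.\<close>
    have path: "\<lbrakk>(v, a) \<in> ?Q; v \<in> insert u U\<rbrakk> \<Longrightarrow> (if v = u then p w else v, a) \<in> ?P" for v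
    proof (induction rule: converse_rtrancl_induct)
      case base
      then show ?case using a u by auto
    next
      case (step y z)
      have z: "z = ?q y" using step by blast
      have yp: "(y, p y) \<in> ?P" for y by blast
      consider "y = u" | "y = w" | "y \<in> U" "y \<noteq> w" "y \<noteq> u"
        using step.prems by blast
      then show ?case
      proof cases
        case 1
        then have "z = p w" using z qu by simp
        then have "z \<in> U" using inU w by simp
        then show ?thesis using step.IH 1 \<open>z = p w\<close> u by auto
      next
        case 2
        then have "z = u" using z qw by simp
        then have "(p w, a) \<in> ?P" using step.IH by simp
        then show ?thesis using 2 w u yp[of w] by (auto intro: rtrancl_trans)
      next
        case 3
        then have "z = p y" using z q by simp
        then have "z \<in> U" using inU 3 by simp
        then have "z \<noteq> u" using u by blast
        then have "(p y, a) \<in> ?P" using step.IH \<open>z \<in> U\<close> \<open>z = p y\<close> by simp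
        then show ?thesis using 3 yp[of y] by (auto intro: rtrancl_trans)
      qed
    qed
    show "absorbed p U a"
    proof (rule absorbedI)
      fix v assume v: "v \<in> U"
      then have "v \<noteq> u" using u by blast
      then show "(v, a) \<in> ?P"
        using path[of v] absorbed_reach[OF *, of v] v by simp
    qed
  next
    assume *: "absorbed p U a"
    have one: "(y, p y) \<in> ?Q" if "y \<in> U" for y
    proof (cases "y = w")
      case True
      have "(w, u) \<in> ?Q" "(u, p w) \<in> ?Q"
        using qw qu by (metis (mono_tags, lifting) mem_Collect_eq r_into_rtrancl)+
      then show ?thesis using True by (auto intro: rtrancl_trans)
    next
      case False
      then show ?thesis using q that by (metis (mono_tags, lifting) mem_Collect_eq r_into_rtrancl)
    qed
    have U: "\<lbrakk>(v, a) \<in> ?P; v \<in> U\<rbrakk> \<Longrightarrow> (v, a) \<in> ?Q" for v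
    proof (induction rule: converse_rtrancl_induct)
      case (step y z)
      then have "z = p y" by blast
      then have "(z, a) \<in> ?Q" using step inU by simp
      with one[OF step.prems] show ?case unfolding \<open>z = p y\<close> by (rule rtrancl_trans)
    qed simp
    have "(u, p w) \<in> ?Q"
      using qu by (metis (mono_tags, lifting) mem_Collect_eq r_into_rtrancl)
    moreover have "(p w, a) \<in> ?Q"
      using U absorbed_reach[OF *] inU w by blast
    ultimately have "(u, a) \<in> ?Q" by (rule rtrancl_trans)
    then show "absorbed ?q (insert u U) a"
      using U absorbed_reach[OF *] by (intro absorbedI) blast
  qed
qed

text \<open>Induction by splicing: a cyclic permutation moving \<open>u\<close> comes from a unique
  smaller one by inserting \<open>u\<close> after one of \<open>1 + card X\<close> elements
  \<open>w\<close>, and \<open>w\<close> is recovered as \<open>inv q u\<close>.\<close>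

lemma card_absorbed_permutations:
  assumes "finite X" "a \<notin> X"
  shows "card {p. p permutes insert a X \<and> absorbed p (insert a X) a} = fact (card X)"
  using assms
proof (induction X rule: finite_induct)
  case empty
  have "{p. p permutes {a} \<and> absorbed p {a} a} = {id}"
    by (auto simp: absorbed_def intro!: exI[of _ 0])
  then show ?case by simp
next
  case (insert u X)
  let ?U = "insert a X"
  let ?N = "\<lambda>U. {p. p permutes U \<and> absorbed p U a}"
  let ?F = "\<lambda>(w, p). p \<circ> transpose u w"
  have u: "u \<notin> ?U" and fin: "finite ?U"
    using insert by auto
  have "bij_betw ?F (?U \<times> ?N ?U) (?N (insert u ?U))"
  proof (rule bij_betw_byWitness[where f' = "\<lambda>q. (inv q u, q \<circ> transpose u (inv q u))"])
    show "\<forall>x\<in>?U \<times> ?N ?U. (\<lambda>q. (inv q u, q \<circ> transpose u (inv q u))) (?F x) = x"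
    proof
      fix x assume "x \<in> ?U \<times> ?N ?U"
      then obtain w p where x: "x = (w, p)" and w: "w \<in> ?U" and p: "p permutes ?U"
        by blast
      have pu: "p u = u" using p u by (simp add: permutes_not_in)
      have "bij (p \<circ> transpose u w)"
        using permutes_bij[OF p] by (intro bij_comp) auto
      moreover have "(p \<circ> transpose u w) w = u" using pu by simp
      ultimately have *: "inv (p \<circ> transpose u w) u = w"
        by (metis bij_inv_eq_iff)
      show "(\<lambda>q. (inv q u, q \<circ> transpose u (inv q u))) (?F x) = x"
        unfolding x by (simp add: * comp_assoc)
    qed
  next
    show "\<forall>q\<in>?N (insert u ?U). ?F (inv q u, q \<circ> transpose u (inv q u)) = q"
      by (simp add: comp_assoc)
  next
    show "?F ` (?U \<times> ?N ?U) \<subseteq> ?N (insert u ?U)"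
    proof clarify
      fix w p assume w: "w \<in> ?U" and p: "p permutes ?U" and ab: "absorbed p ?U a"
      have "p permutes insert u ?U" "transpose u w permutes insert u ?U"
        using p w by (auto intro: permutes_subset permutes_swap_id)
      then have "p \<circ> transpose u w permutes insert u ?U"
        by (rule permutes_compose[rotated])
      moreover have "absorbed (p \<circ> transpose u w) (insert u ?U) a"
        using absorbed_insert[OF w u _ p] ab by blast
      ultimately show "p \<circ> transpose u w permutes insert u ?U \<and>
          absorbed (p \<circ> transpose u w) (insert u ?U) a"
        by blast
    qed
  next
    show "(\<lambda>q. (inv q u, q \<circ> transpose u (inv q u))) ` ?N (insert u ?U) \<subseteq> ?U \<times> ?N ?U"
    proof (rule image_subsetI)
      fix q assume "q \<in> ?N (insert u ?U)"
      then have q: "q permutes insert u ?U" and ab: "absorbed q (insert u ?U) a"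
        by auto
      define w where "w = inv q u"
      have qw: "q w = u"
        using q unfolding w_def by (simp add: permutes_inverses)
      have wU: "w \<in> insert u ?U"
        using q qw by (metis insertI1 permutes_in_image)
      \<comment> \<open>A fixed point \<open>u\<close> could never reach \<open>a\<close>.\<close>
      have "w \<noteq> u"
      proof
        assume "w = u"
        then have fixed: "(q ^^ k) u = u" for k
          using qw by (induction k) auto
        obtain k where "(q ^^ k) u = a"
          using ab unfolding absorbed_def by blast
        then show False using fixed[of k] u by simp
      qed
      with wU have w: "w \<in> ?U" by blast
      define p where "p = q \<circ> transpose u w"
      have "p permutes insert u ?U"
        unfolding p_def using q w by (intro permutes_compose permutes_swap_id) auto
      moreover have "p u = u" using qw unfolding p_def by simp
      ultimately have p: "p permutes ?U"
        using permutes_superset[of p "insert u ?U" ?U] by auto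
      have "p \<circ> transpose u w = q"
        unfolding p_def by (simp add: comp_assoc)
      then have "absorbed p ?U a"
        using absorbed_insert[OF w u _ p] ab by simp
      then show "(inv q u, q \<circ> transpose u (inv q u)) \<in> ?U \<times> ?N ?U"
        using w p unfolding p_def w_def by simp
    qed
  qed
  from bij_betw_same_card[OF this] have "card (?N (insert u ?U)) = card ?U * card (?N ?U)"
    by (simp only: card_cartesian_product)
  also have "\<dots> = fact (card (insert u X))"
    using insert by simp
  finally show ?case
    by (simp add: insert_commute)
qed

text \<open>Permutations of \<open>U\<close> fixing \<open>a\<close> are the permutations of
  \<open>U - {a}\<close>, so both sets have \<open>fact (card U - 1)\<close> elements. The bijection
  comes from this count alone.\<close>

lemma ex_bij_fixing_absorbed_permutations:
  assumes "finite U" "a \<in> U"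
  shows "\<exists>\<beta>. bij_betw \<beta> {p. p permutes U \<and> p a = a} {p. p permutes U \<and> absorbed p U a}"
proof -
  have eq: "{p. p permutes U \<and> p a = a} = {p. p permutes (U - {a})}"
    by (auto intro: permutes_superset permutes_subset simp: permutes_not_in)
  have "card {p. p permutes U \<and> p a = a} = card {p. p permutes U \<and> absorbed p U a}"
    using assms card_absorbed_permutations[of "U - {a}" a] card_permutations[of "U - {a}"]
    unfolding eq by (simp add: insert_absorb)
  moreover have "finite {p. p permutes U}"
    using assms(1) by (rule finite_permutations)
  ultimately show ?thesis
    by (intro finite_same_card_bij) (auto elim: rev_finite_subset)
qed

section \<open>First return maps\<close>

definition return_time :: "('a \<Rightarrow> 'a) \<Rightarrow> 'a set \<Rightarrow> 'a \<Rightarrow> nat" where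
  "return_time p U u = (LEAST k. 0 < k \<and> (p ^^ k) u \<in> U)"

definition first_return :: "('a \<Rightarrow> 'a) \<Rightarrow> 'a set \<Rightarrow> 'a \<Rightarrow> 'a" where
  "first_return p U u = (if u \<in> U then (p ^^ return_time p U u) u else u)"

definition periodic :: "('a \<Rightarrow> 'a) \<Rightarrow> 'a \<Rightarrow> bool" where
  "periodic p u \<longleftrightarrow> (\<exists>k>0. (p ^^ k) u = u)"

lemma return_time:
  assumes "periodic p u" "u \<in> U"
  shows "0 < return_time p U u" "(p ^^ return_time p U u) u \<in> U"
    "\<And>j. 0 < j \<Longrightarrow> j < return_time p U u \<Longrightarrow> (p ^^ j) u \<notin> U"
    "\<And>j. 0 < j \<Longrightarrow> (p ^^ j) u \<in> U \<Longrightarrow> return_time p U u \<le> j"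
proof -
  obtain k where "0 < k \<and> (p ^^ k) u \<in> U"
    using assms unfolding periodic_def by metis
  then have "0 < return_time p U u \<and> (p ^^ return_time p U u) u \<in> U"
    unfolding return_time_def by (rule LeastI)
  then show "0 < return_time p U u" "(p ^^ return_time p U u) u \<in> U" by auto
  show le: "return_time p U u \<le> j" if "0 < j" "(p ^^ j) u \<in> U" for j
    unfolding return_time_def using that by (intro Least_le) simp
  show "(p ^^ j) u \<notin> U" if "0 < j" "j < return_time p U u" for j
    using le[of j] that by linarith
qed

lemma periodic_mult:
  assumes "(p ^^ k) u = u"
  shows "(p ^^ (c * k)) u = u"
  by (induction c) (simp_all add: funpow_add assms)

text \<open>From exponent \<open>j\<close> on the two orbits coincide, and at a common multiple
  \<open>N \<ge> j\<close> of the two periods they are back at \<open>u\<close> and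
  \<open>v\<close>.\<close>

lemma periodic_funpow_inject:
  assumes "periodic p u" "periodic p v" "(p ^^ j) u = (p ^^ j) v"
  shows "u = v"
proof -
  obtain k l where k: "0 < k" "(p ^^ k) u = u" and l: "0 < l" "(p ^^ l) v = v"
    using assms unfolding periodic_def by blast
  define N where "N = Suc j * (k * l)"
  have "(p ^^ N) u = u" "(p ^^ N) v = v"
    using periodic_mult[OF k(2), of "Suc j * l"] periodic_mult[OF l(2), of "Suc j * k"]
    unfolding N_def by (simp_all add: algebra_simps)
  moreover have "j \<le> N"
  proof -
    have "Suc j * 1 \<le> Suc j * (k * l)"
      using k(1) l(1) by (intro mult_le_mono) auto
    then show ?thesis unfolding N_def mult_1_right by (rule Suc_leD)
  qed
  then have "(p ^^ N) w = (p ^^ (N - j)) ((p ^^ j) w)" for w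
    by (metis comp_apply funpow_add le_add_diff_inverse2)
  ultimately show ?thesis
    using assms(3) by metis
qed

lemma periodic_funpow:
  assumes "periodic p u"
  shows "periodic p ((p ^^ j) u)"
proof -
  obtain k where k: "0 < k" "(p ^^ k) u = u"
    using assms unfolding periodic_def by blast
  have "(p ^^ k) ((p ^^ j) u) = (p ^^ j) ((p ^^ k) u)"
    by (metis add.commute comp_apply funpow_add)
  then show ?thesis
    using k unfolding periodic_def by auto
qed

lemma periodic_back:
  assumes "periodic p u"
  shows "\<exists>l. (p ^^ l) ((p ^^ j) u) = u"
proof -
  obtain k where k: "0 < k" "(p ^^ k) u = u"
    using assms unfolding periodic_def by blast
  have "j \<le> j * k" using k(1) by simp
  then have "(p ^^ (j * k - j)) ((p ^^ j) u) = (p ^^ (j * k)) u"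
    by (metis comp_apply funpow_add le_add_diff_inverse2)
  then show ?thesis
    using periodic_mult[OF k(2)] by metis
qed

text \<open>If \<open>u\<close> and \<open>v\<close> return to the same point after times
  \<open>s \<le> t\<close>, cancelling \<open>s\<close> steps gives
  \<open>u = (p ^^ (t - s)) v\<close>. Unless \<open>s = t\<close>, this is a visit of the orbit of
  \<open>v\<close> to \<open>U\<close> before its first return.\<close>

lemma first_return_permutes:
  assumes "finite U" and per: "\<And>u. u \<in> U \<Longrightarrow> periodic p u"
  shows "first_return p U permutes U"
proof -
  have inj: "u = v" if uv: "u \<in> U" "v \<in> U" "first_return p U u = first_return p U v"
    and le: "return_time p U u \<le> return_time p U v" for u v
  proof -
    let ?s = "return_time p U u" and ?t = "return_time p U v"
    have "(p ^^ ?s) u = (p ^^ ?s) ((p ^^ (?t - ?s)) v)"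
      using uv le unfolding first_return_def by (metis comp_apply funpow_add le_add_diff_inverse)
    then have *: "u = (p ^^ (?t - ?s)) v"
      using periodic_funpow_inject per uv periodic_funpow by metis
    then have "\<not> 0 < ?t - ?s"
      using return_time(1)[OF per uv(1)] return_time(3)[OF per uv(2), of "?t - ?s"] uv by auto
    then show ?thesis using * by simp
  qed
  have "inj_on (first_return p U) U"
    using inj by (intro inj_onI) (metis nat_le_linear)
  moreover have "first_return p U ` U \<subseteq> U"
    using return_time(2)[OF per] unfolding first_return_def by auto
  ultimately have "bij_betw (first_return p U) U U"
    using assms(1) by (simp add: bij_betw_def endo_inj_surj)
  then show ?thesis
    by (rule bij_imp_permutes) (simp add: first_return_def)
qed

text \<open>Iterating the first return map lists the visits of the \<open>p\<close>-orbit to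
  \<open>U\<close>, and reaching \<open>a\<close> is such a visit.\<close>

lemma first_return_absorbed:
  assumes per: "\<And>u. u \<in> U \<Longrightarrow> periodic p u" and a: "a \<in> U"
  shows "absorbed (first_return p U) U a \<longleftrightarrow> absorbed p U a"
proof
  assume "absorbed p U a"
  moreover have "v \<in> U \<Longrightarrow> (p ^^ k) v = a \<Longrightarrow> \<exists>l. (first_return p U ^^ l) v = a" for v k
  proof (induction k arbitrary: v rule: less_induct)
    case (less k)
    show ?case
    proof (cases "k = 0")
      case True
      then have "(first_return p U ^^ 0) v = a" using less by simp
      then show ?thesis by blast
    next
      case False
      let ?t = "return_time p U v"
      have t: "?t \<le> k" "0 < ?t" "first_return p U v \<in> U" "first_return p U v = (p ^^ ?t) v"
        using return_time[OF per[OF less.prems(1)] less.prems(1)] False less.prems a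
        unfolding first_return_def by auto
      have "(p ^^ (k - ?t)) (first_return p U v) = a"
        using t(1,4) less.prems(2) by (metis comp_apply funpow_add le_add_diff_inverse2)
      then obtain l where "(first_return p U ^^ l) (first_return p U v) = a"
        using less.IH[of "k - ?t"] t False by auto
      then have "(first_return p U ^^ Suc l) v = a"
        by (simp add: funpow_swap1)
      then show ?thesis by blast
    qed
  qed
  ultimately show "absorbed (first_return p U) U a"
    unfolding absorbed_def by blast
next
  assume *: "absorbed (first_return p U) U a"
  have iterate: "\<exists>j. (first_return p U ^^ l) v = (p ^^ j) v" for l v
  proof (induction l)
    case 0
    have "(first_return p U ^^ 0) v = (p ^^ 0) v" by simp
    then show ?case by blast
  next
    case (Suc l)
    then obtain j where j: "(first_return p U ^^ l) v = (p ^^ j) v" by blast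
    have "\<exists>t. first_return p U x = (p ^^ t) x" for x
      unfolding first_return_def by (metis funpow_0)
    then obtain t where "first_return p U ((p ^^ j) v) = (p ^^ t) ((p ^^ j) v)" by blast
    then have "(first_return p U ^^ Suc l) v = (p ^^ (t + j)) v"
      using j by (simp add: funpow_add)
    then show ?case by blast
  qed
  show "absorbed p U a"
    unfolding absorbed_def
  proof
    fix v assume "v \<in> U"
    then obtain l where "(first_return p U ^^ l) v = a"
      using * unfolding absorbed_def by blast
    then show "\<exists>k. (p ^^ k) v = a"
      using iterate[of l v] by auto
  qed
qed

text \<open>Along these orbits \<open>\<pi>\<close> fixes every point outside \<open>U\<close>, so
  \<open>q\<close> follows \<open>p\<close> during an excursion and \<open>\<pi>\<close> takes
  effect just once, at the return.\<close>

lemma first_return_compose: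
  assumes per: "\<And>u. u \<in> U \<Longrightarrow> periodic p u"
    and q: "\<And>u j. u \<in> U \<Longrightarrow> q ((p ^^ j) u) = \<pi> (p ((p ^^ j) u))"
    and out: "\<And>u j. u \<in> U \<Longrightarrow> (p ^^ j) u \<notin> U \<Longrightarrow> \<pi> ((p ^^ j) u) = (p ^^ j) u"
    and "in": "\<And>u. u \<in> U \<Longrightarrow> \<pi> u \<in> U"
    and u: "u \<in> U"
  shows "first_return q U u = \<pi> (first_return p U u)"
proof -
  let ?t = "return_time p U u"
  note t = return_time[OF per[OF u] u]
  have less: "(q ^^ j) u = (p ^^ j) u" if "j < ?t" for j
    using that
  proof (induction j)
    case (Suc j)
    then have "(q ^^ Suc j) u = \<pi> ((p ^^ Suc j) u)"
      using q[OF u, of j] by simp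
    moreover have "(p ^^ Suc j) u \<notin> U"
      using t(3)[of "Suc j"] Suc.prems by simp
    ultimately show ?case
      using out[OF u, of "Suc j"] by simp
  qed simp
  obtain s where s: "?t = Suc s"
    using t(1) gr0_conv_Suc by auto
  have eq: "(q ^^ ?t) u = \<pi> ((p ^^ ?t) u)"
    using less[of s] q[OF u, of s] s by simp
  have "return_time q U u = ?t"
    unfolding return_time_def[of q]
  proof (rule Least_equality)
    show "0 < ?t \<and> (q ^^ ?t) u \<in> U"
      using t(1,2) eq "in" by simp
    show "?t \<le> j" if "0 < j \<and> (q ^^ j) u \<in> U" for j
      using that less[of j] t(4)[of j] by (cases "j < ?t") auto
  qed
  then show ?thesis
    using eq u unfolding first_return_def by simp
qed

section \<open>Maps with a distinguished cut at each level\<close>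

lemma funpow_cong_orbit:
  assumes "\<And>l. l < k \<Longrightarrow> f ((f ^^ l) v) = g ((f ^^ l) v)"
  shows "(f ^^ k) v = (g ^^ k) v"
  using assms
proof (induction k)
  case (Suc k)
  then have "(f ^^ k) v = (g ^^ k) v" by simp
  then show ?case using Suc.prems[of k] by simp
qed simp

lemma funpow_closed:
  assumes "\<And>x. x \<in> X \<Longrightarrow> f x \<in> X" "v \<in> X"
  shows "(f ^^ k) v \<in> X"
  by (induction k) (auto intro: assms)

text \<open>By the pigeonhole principle the orbit repeats, and injectivity cancels the
  preperiod.\<close>

lemma inj_on_finite_periodic:
  assumes "finite X" and closed: "\<And>x. x \<in> X \<Longrightarrow> f x \<in> X" and inj: "inj_on f X" and v: "v \<in> X"
  shows "periodic f v"
proof -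
  have "range (\<lambda>k. (f ^^ k) v) \<subseteq> X"
    using funpow_closed[of X f, OF closed v] by blast
  then have "\<not> inj (\<lambda>k. (f ^^ k) v)"
    using assms(1) finite_imageD[of "\<lambda>k. (f ^^ k) v" UNIV] finite_subset by blast
  then obtain a b where "(f ^^ a) v = (f ^^ b) v" "a < b"
    by (metis (mono_tags, lifting) injI linorder_neqE_nat)
  then have "(f ^^ a) v = (f ^^ a) ((f ^^ (b - a)) v)"
    by (metis comp_apply funpow_add le_add_diff_inverse less_imp_le_nat)
  moreover have "(f ^^ a) x = (f ^^ a) y \<Longrightarrow> x \<in> X \<Longrightarrow> y \<in> X \<Longrightarrow> x = y" for x y
  proof (induction a)
    case (Suc a)
    then show ?case
      using inj_onD[OF inj, of "(f ^^ a) x" "(f ^^ a) y"] funpow_closed[of X f, OF closed] by simp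
  qed simp
  ultimately have "(f ^^ (b - a)) v = v"
    using v funpow_closed[of X f, OF closed v] by metis
  then show ?thesis
    using \<open>a < b\<close> unfolding periodic_def by (intro exI[of _ "b - a"]) simp
qed

section \<open>Base vertices and descending orbits\<close>

definition base :: "nat \<Rightarrow> vertex" where
  "base i = (i, 1)"

lemma fst_base [simp]: "fst (base i) = i"
  by (simp add: base_def)

lemma base_eq_iff [simp]: "base i = base j \<longleftrightarrow> i = j"
  by (simp add: base_def)

text \<open>A region \<open>D j\<close> can be left only through \<open>base j\<close>, and then
  only into \<open>D (j - 1)\<close>. An orbit falling from \<open>D j\<close> to level
  \<open>i\<close> or lower thus runs through the base vertices of levels \<open>j\<close>, ...,
  \<open>i + 1\<close> in turn. Map and regions are independent parameters because \<open>h\<close>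
  and \<open>act h \<nu>\<close> will both be studied with the regions of \<open>h\<close>.\<close>

lemma descent:
  assumes stay: "\<And>j y. j \<le> r \<Longrightarrow> y \<in> D j \<Longrightarrow> y \<noteq> base j \<Longrightarrow> g y \<in> D j"
    and drop: "\<And>j. 0 < j \<Longrightarrow> j \<le> r \<Longrightarrow> g (base j) \<in> D (j - 1)"
    and lev: "\<And>j y. y \<in> D j \<Longrightarrow> j \<le> fst y"
  shows "j \<le> r \<Longrightarrow> i < j \<Longrightarrow> u \<in> D j \<Longrightarrow> fst ((g ^^ k) u) \<le> i \<Longrightarrow>
    \<exists>l<k. (g ^^ l) u = base (Suc i)"
proof (induction j arbitrary: u k)
  case (Suc j)
  have "\<exists>l<k. (g ^^ l) u = base (Suc j)"
  proof (rule ccontr)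
    assume no: "\<not> ?thesis"
    \<comment> \<open>Until \<open>base (Suc j)\<close> is met the orbit is confined to
      \<open>D (Suc j)\<close>, which lies above level \<open>i\<close>.\<close>
    have "(g ^^ l) u \<in> D (Suc j)" if "l \<le> k" for l
      using that
    proof (induction l)
      case (Suc l)
      then show ?case using stay[OF \<open>Suc j \<le> r\<close>] no by simp
    qed (simp add: \<open>u \<in> D (Suc j)\<close>)
    then show False
      using lev[of "(g ^^ k) u" "Suc j"] Suc.prems by simp
  qed
  then obtain l where l: "l < k" "(g ^^ l) u = base (Suc j)" by blast
  show ?case
  proof (cases "j = i")
    case False
    have "(g ^^ Suc l) u \<in> D j"
      using drop[of "Suc j"] Suc.prems(1) l by simp
    moreover have "(g ^^ (k - Suc l)) ((g ^^ Suc l) u) = (g ^^ k) u"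
      using l(1) by (metis Suc_leI comp_apply funpow_add le_add_diff_inverse2)
    ultimately obtain l' where l': "l' < k - Suc l" "(g ^^ l') ((g ^^ Suc l) u) = base (Suc i)"
      using Suc.IH[of "(g ^^ Suc l) u" "k - Suc l"] Suc.prems False by auto
    then have "(g ^^ (l' + Suc l)) u = base (Suc i)"
      by (metis comp_apply funpow_add)
    then show ?thesis using l'(1) by (intro exI[of _ "l' + Suc l"]) simp
  qed (use l in blast)
qed simp

locale layered =
  fixes n :: "nat \<Rightarrow> nat" and r :: nat and S :: "int set"
  assumes n_pos: "i \<le> r \<Longrightarrow> 0 < n i"
    and S_le_1: "s \<in> S \<Longrightarrow> s \<le> 1"
begin

abbreviation V :: "vertex set" where
  "V \<equiv> vertices n r"

lemma finite_V: "finite V"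
  unfolding vertices_def by simp

lemma base_in_V: "i \<le> r \<Longrightarrow> base i \<in> V"
  using n_pos[of i] unfolding vertices_def base_def by simp

lemma fst_le: "v \<in> V \<Longrightarrow> fst v \<le> r"
  unfolding vertices_def by auto

text \<open>In both kinds of maps the orbit of \<open>base 0\<close>, closed up by an extra arc from \<open>base 0\<close> to
  level \<open>r\<close>, enters level \<open>i\<close> through \<open>src i\<close> and leaves the levels \<open>\<ge> i\<close> through \<open>base i\<close>.
  The map \<open>cut h i\<close> bypasses everything in between.\<close>

definition src :: "nat \<Rightarrow> vertex" where
  "src i = (if i = r then base 0 else base (Suc i))"

definition cut :: "(vertex \<Rightarrow> vertex) \<Rightarrow> nat \<Rightarrow> vertex \<Rightarrow> vertex" where
  "cut h i = h(base i := h (src i))"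

definition entries :: "(vertex \<Rightarrow> vertex) \<Rightarrow> nat \<Rightarrow> vertex set" where
  "entries h i = {v \<in> V. fst v = i \<and> periodic (cut h i) v \<and> (\<forall>j. i \<le> fst ((cut h i ^^ j) v))}"

text \<open>The union of the cycles of \<open>cut h i\<close> whose lowest level is exactly
  \<open>i\<close>. For admissible \<open>h\<close> one of them is the closed-up excursion through
  \<open>base i\<close>.\<close>

definition core :: "(vertex \<Rightarrow> vertex) \<Rightarrow> nat \<Rightarrow> vertex set" where
  "core h i = {(cut h i ^^ j) v |j v. v \<in> entries h i}"

text \<open>The common class of the two kinds of closed-up maps. The vertex \<open>base 0\<close> is
  exempt from the step condition because its arc is the extra one to level \<open>r\<close>. The
  last clause says that the excursion opened by the arc from \<open>src i\<close> starts at level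
  \<open>i\<close>, stays at levels \<open>\<ge> i\<close> and ends at
  \<open>base i\<close>.\<close>

definition admissible :: "(vertex \<Rightarrow> vertex) \<Rightarrow> bool" where
  "admissible h \<longleftrightarrow>
    (\<forall>v. v \<notin> V \<longrightarrow> h v = v) \<and>
    (\<forall>v\<in>V. h v \<in> V) \<and>
    (\<forall>v\<in>V - {base 0}. int (fst v) - int (fst (h v)) \<in> S) \<and>
    (\<forall>i\<le>r. fst (h (src i)) = i \<and> base i \<in> entries h i)"

definition return_map :: "(vertex \<Rightarrow> vertex) \<Rightarrow> nat \<Rightarrow> vertex \<Rightarrow> vertex" where
  "return_map h i = first_return (cut h i) (entries h i)"

lemma src_in_V: "i \<le> r \<Longrightarrow> src i \<in> V"
  unfolding src_def by (auto intro: base_in_V)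

lemma admissible_D:
  assumes "admissible h"
  shows "v \<notin> V \<Longrightarrow> h v = v" "v \<in> V \<Longrightarrow> h v \<in> V"
    "v \<in> V \<Longrightarrow> v \<noteq> base 0 \<Longrightarrow> int (fst v) - int (fst (h v)) \<in> S"
    "i \<le> r \<Longrightarrow> fst (h (src i)) = i" "i \<le> r \<Longrightarrow> base i \<in> entries h i"
  using assms unfolding admissible_def by blast+

lemma cut_base: "cut h i (base i) = h (src i)"
  unfolding cut_def by simp

lemma cut_other: "v \<noteq> base i \<Longrightarrow> cut h i v = h v"
  unfolding cut_def by simp

lemma finite_entries: "finite (entries h i)"
  using finite_V unfolding entries_def by simp

lemma entries_D:
  assumes "v \<in> entries h i"
  shows "v \<in> V" "fst v = i" "i \<le> r" "periodic (cut h i) v" "i \<le> fst ((cut h i ^^ j) v)"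
  using assms fst_le[of v] unfolding entries_def by auto

lemma entries_subset_core: "entries h i \<subseteq> core h i"
proof
  fix v assume "v \<in> entries h i"
  then show "v \<in> core h i"
    unfolding core_def by (intro CollectI exI[of _ 0] exI[of _ v]) simp
qed

lemma core_closed:
  assumes "v \<in> core h i"
  shows "cut h i v \<in> core h i"
proof -
  obtain j u where "v = (cut h i ^^ j) u" "u \<in> entries h i"
    using assms unfolding core_def by blast
  then have "cut h i v = (cut h i ^^ Suc j) u" "u \<in> entries h i" by simp_all
  then show ?thesis unfolding core_def by blast
qed

lemma core_periodic: "v \<in> core h i \<Longrightarrow> periodic (cut h i) v"
  unfolding core_def by (auto intro: periodic_funpow entries_D(4))

lemma core_level: "v \<in> core h i \<Longrightarrow> i \<le> fst v"
  unfolding core_def by (auto intro: entries_D(5))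

lemma core_reach_entries:
  assumes "v \<in> core h i"
  shows "\<exists>k. (cut h i ^^ k) v \<in> entries h i"
proof -
  obtain j u where v: "v = (cut h i ^^ j) u" and u: "u \<in> entries h i"
    using assms unfolding core_def by blast
  obtain l where "(cut h i ^^ l) v = u"
    using periodic_back[OF entries_D(4)[OF u], of j] v by blast
  then show ?thesis using u by blast
qed

lemma core_nonempty_level: "v \<in> core h i \<Longrightarrow> i \<le> r"
  using core_reach_entries entries_D(3) by blast

lemma cut_in_V: "admissible h \<Longrightarrow> i \<le> r \<Longrightarrow> v \<in> V \<Longrightarrow> cut h i v \<in> V"
  unfolding cut_def using admissible_D(2) src_in_V by auto

lemma core_subset_V: "admissible h \<Longrightarrow> core h i \<subseteq> V"
  unfolding core_def by (auto intro!: funpow_closed[of V "cut h i"] cut_in_V intro: entries_D(1,3))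

lemma core_level_eq:
  assumes "admissible h" "v \<in> core h i" "fst v = i"
  shows "v \<in> entries h i"
proof -
  have "i \<le> fst ((cut h i ^^ j) v)" for j
    using funpow_closed[of "core h i" "cut h i"] core_closed assms(2) core_level by blast
  then show ?thesis
    using assms core_subset_V core_periodic unfolding entries_def by blast
qed

lemma cut_inj_on_core: "inj_on (cut h i) (core h i)"
proof (rule inj_onI)
  fix x y assume "x \<in> core h i" "y \<in> core h i" "cut h i x = cut h i y"
  then show "x = y"
    using periodic_funpow_inject[of "cut h i" x y 1] core_periodic by simp
qed

lemma base_in_core: "admissible h \<Longrightarrow> i \<le> r \<Longrightarrow> base i \<in> core h i"
  using admissible_D(5) entries_subset_core by blast

lemma h_src_in_entries:
  assumes "admissible h" "i \<le> r"
  shows "h (src i) \<in> entries h i"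
proof -
  have "h (src i) \<in> core h i"
    using core_closed[OF base_in_core[OF assms]] cut_base by simp
  then show ?thesis
    using core_level_eq admissible_D(4) assms by blast
qed

lemma src_less: "0 < j \<Longrightarrow> j \<le> r \<Longrightarrow> src (j - 1) = base j"
  unfolding src_def by simp

lemma h_base_drop: "admissible h \<Longrightarrow> 0 < j \<Longrightarrow> j \<le> r \<Longrightarrow> h (base j) \<in> entries h (j - 1)"
  using h_src_in_entries[of h "j - 1"] src_less[of j] by simp

text \<open>On its way down to level \<open>i\<close>, the orbit of a common vertex would have to
  pass \<open>base (Suc i)\<close>, which is \<open>src i\<close>. But \<open>cut h i\<close> sends
  both \<open>base i\<close> and \<open>base (Suc i)\<close> to \<open>h (src i)\<close>, and it is
  injective on \<open>core h i\<close>.\<close>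

lemma core_disjoint_less:
  assumes K: "admissible h" and "i < j"
  shows "core h i \<inter> core h j = {}"
proof (rule ccontr)
  assume "core h i \<inter> core h j \<noteq> {}"
  then obtain u where ui: "u \<in> core h i" and uj: "u \<in> core h j" by blast
  have j: "j \<le> r" using uj core_nonempty_level by blast
  have "\<exists>k. fst ((cut h i ^^ k) u) = i"
    using core_reach_entries[OF ui] entries_D(2) by blast
  then obtain k where k: "fst ((cut h i ^^ k) u) = i"
    and min: "\<And>l. l < k \<Longrightarrow> fst ((cut h i ^^ l) u) \<noteq> i"
    using exists_least_iff[of "\<lambda>k. fst ((cut h i ^^ k) u) = i"] by blast
  \<comment> \<open>Before level \<open>i\<close> is reached the orbit has not met
    \<open>base i\<close>, so cutting changes nothing.\<close>
  have agree: "(cut h i ^^ l) u = (h ^^ l) u" if "l \<le> k" for l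
    using that min by (intro funpow_cong_orbit cut_other) (metis fst_base less_le_trans)
  have "\<exists>l<k. (h ^^ l) u = base (Suc i)"
  proof (rule descent[where D = "core h" and r = r])
    show "h y \<in> core h j" if "y \<in> core h j" "y \<noteq> base j" for j y
      using core_closed[OF that(1)] cut_other[OF that(2)] by simp
    show "h (base j) \<in> core h (j - 1)" if "0 < j" "j \<le> r" for j
      using h_base_drop[OF K that] entries_subset_core by blast
  qed (use core_level assms j uj k agree[of k] in auto)
  then obtain l where l: "l < k" "(cut h i ^^ l) u = base (Suc i)"
    using agree by auto
  then have Suc: "base (Suc i) \<in> core h i"
    using funpow_closed[of "core h i" "cut h i"] core_closed ui by metis
  have eq: "cut h i (base (Suc i)) = cut h i (base i)"
    using assms(2) j unfolding cut_base by (subst cut_other) (auto simp: src_def)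
  have "base i \<in> core h i"
    using base_in_core[OF K] assms(2) j by simp
  then have "base (Suc i) = base i"
    by (rule inj_onD[OF cut_inj_on_core eq Suc])
  then show False by simp
qed

lemma core_disjoint: "admissible h \<Longrightarrow> v \<in> core h i \<Longrightarrow> v \<in> core h j \<Longrightarrow> i = j"
  using core_disjoint_less[of h i j] core_disjoint_less[of h j i] by (cases i j rule: linorder_cases) auto

lemma return_map_permutes: "return_map h i permutes entries h i"
  unfolding return_map_def using finite_entries entries_D(4) by (rule first_return_permutes)

subsection \<open>Prescribing the first return maps\<close>

text \<open>Arcs are selected by their tails. If \<open>0 \<in> S\<close>, moving all of them
  amounts to relabelling heads, which carries in-types along. If \<open>0 \<notin> S\<close>, moving
  only those on the cores will leave each in-type in place.\<close>

definition rerouted :: "(vertex \<Rightarrow> vertex) \<Rightarrow> vertex set" where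
  "rerouted h = (if 0 \<in> S then UNIV else (\<Union>i\<le>r. core h i))"

text \<open>On \<open>entries h i\<close> this undoes the present return map and then applies
  \<open>\<nu> i\<close>, so that the return map followed by it is \<open>\<nu> i\<close>.\<close>

definition redirect :: "(vertex \<Rightarrow> vertex) \<Rightarrow> (nat \<Rightarrow> vertex \<Rightarrow> vertex) \<Rightarrow> vertex \<Rightarrow> vertex" where
  "redirect h \<nu> x = (if x \<in> entries h (fst x) then \<nu> (fst x) (inv (return_map h (fst x)) x) else x)"

definition act :: "(vertex \<Rightarrow> vertex) \<Rightarrow> (nat \<Rightarrow> vertex \<Rightarrow> vertex) \<Rightarrow> vertex \<Rightarrow> vertex" where
  "act h \<nu> v = (if v \<in> rerouted h then redirect h \<nu> (h v) else h v)"

lemma core_subset_rerouted: "core h i \<subseteq> rerouted h"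
  unfolding rerouted_def using core_nonempty_level[of _ h i] by auto

context
  fixes h :: "vertex \<Rightarrow> vertex" and \<nu> :: "nat \<Rightarrow> vertex \<Rightarrow> vertex"
  assumes K: "admissible h" and \<nu>: "\<And>i. i \<le> r \<Longrightarrow> \<nu> i permutes entries h i"
begin

lemma redirect_entries: "x \<in> entries h i \<Longrightarrow> redirect h \<nu> x = \<nu> i (inv (return_map h i) x)"
  unfolding redirect_def using entries_D(2) by auto

lemma redirect_in_entries:
  assumes "x \<in> entries h i"
  shows "redirect h \<nu> x \<in> entries h i"
  using assms \<nu>[of i] entries_D(3)[OF assms] permutes_inv[OF return_map_permutes, of h i]
  by (simp add: redirect_entries permutes_in_image)

lemma redirect_not_entries: "x \<notin> entries h (fst x) \<Longrightarrow> redirect h \<nu> x = x"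
  unfolding redirect_def by simp

lemma fst_redirect: "fst (redirect h \<nu> x) = fst x"
proof (cases "x \<in> entries h (fst x)")
  case True
  then show ?thesis using redirect_in_entries[OF True] entries_D(2) by blast
qed (simp add: redirect_not_entries)

lemma redirect_permutes: "redirect h \<nu> permutes V"
proof -
  have "inj_on (redirect h \<nu>) V"
  proof (rule inj_onI)
    fix x y assume eq: "redirect h \<nu> x = redirect h \<nu> y"
    then have fst: "fst x = fst y" using fst_redirect by metis
    show "x = y"
    proof (cases "x \<in> entries h (fst x)")
      case True
      then have y: "y \<in> entries h (fst x)"
        using redirect_in_entries[OF True] eq redirect_not_entries fst by metis
      have "\<nu> (fst x) (inv (return_map h (fst x)) x) = \<nu> (fst x) (inv (return_map h (fst x)) y)"
        using eq redirect_entries True y by simp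
      then show ?thesis
        using permutes_inj[OF \<nu>[of "fst x"]] permutes_inj[OF permutes_inv[OF return_map_permutes]] entries_D(3)[OF True]
        by (metis injD)
    next
      case False
      then show ?thesis
        using eq redirect_in_entries[of y "fst y"] redirect_not_entries fst by metis
    qed
  qed
  moreover have "redirect h \<nu> ` V \<subseteq> V"
    using redirect_in_entries redirect_not_entries entries_D(1) by (metis image_subsetI)
  ultimately have "bij_betw (redirect h \<nu>) V V"
    using finite_V by (simp add: bij_betw_def endo_inj_surj)
  then show ?thesis
    using redirect_not_entries entries_D(1) by (intro bij_imp_permutes) blast+
qed

lemma fst_act: "fst (act h \<nu> v) = fst (h v)"
  unfolding act_def by (simp add: fst_redirect)

lemma cut_act:
  assumes "v \<in> core h i"
  shows "cut (act h \<nu>) i v = redirect h \<nu> (cut h i v)"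
proof (cases "v = base i")
  case True
  have i: "i \<le> r" using assms core_nonempty_level by blast
  \<comment> \<open>The vertex \<open>src i\<close> is \<open>base 0\<close> or
    \<open>base (Suc i)\<close> and lies in the core of its own level, so the arc glued to
    \<open>base i\<close> is redirected like the others.\<close>
  have "src i \<in> rerouted h"
    using base_in_core[OF K, of 0] base_in_core[OF K, of "Suc i"] i core_subset_rerouted
    unfolding src_def by (cases "i = r") auto
  then show ?thesis
    unfolding True cut_base act_def by simp
next
  case False
  then show ?thesis
    using assms core_subset_rerouted unfolding cut_other[OF False] act_def by auto
qed

text \<open>A moved vertex is an entry of its own level, and disjointness of the cores identifies
  this level with \<open>i\<close>. Hence redirecting never mixes cores.\<close>

lemma redirect_in_core:
  assumes "x \<in> core h i"
  shows "redirect h \<nu> x \<in> core h i"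
proof (cases "x \<in> entries h (fst x)")
  case True
  then have "fst x = i"
    using core_disjoint[OF K assms] entries_subset_core by blast
  then show ?thesis
    using redirect_in_entries[OF True] entries_subset_core by blast
qed (simp add: redirect_not_entries assms)

lemma cut_act_in_core: "v \<in> core h i \<Longrightarrow> cut (act h \<nu>) i v \<in> core h i"
  using cut_act redirect_in_core core_closed by simp

text \<open>On the finite core the new cut map is the old one followed by a permutation, hence
  injective.\<close>

lemma cut_act_periodic:
  assumes "v \<in> core h i"
  shows "periodic (cut (act h \<nu>) i) v"
proof (rule inj_on_finite_periodic[OF _ cut_act_in_core _ assms])
  show "finite (core h i)"
    using finite_V core_subset_V[OF K] by (rule rev_finite_subset)
  show "inj_on (cut (act h \<nu>) i) (core h i)"
  proof (rule inj_onI)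
    fix x y assume xy: "x \<in> core h i" "y \<in> core h i" "cut (act h \<nu>) i x = cut (act h \<nu>) i y"
    then have "cut h i x = cut h i y"
      using cut_act permutes_inj[OF redirect_permutes] by (metis injD)
    then show "x = y"
      using cut_inj_on_core xy by (meson inj_onD)
  qed
qed

lemma act_base_drop: "0 < j \<Longrightarrow> j \<le> r \<Longrightarrow> act h \<nu> (base j) \<in> core h (j - 1)"
  using cut_act_in_core[OF base_in_core[OF K], of "j - 1"] src_less[of j] by (simp add: cut_base)

text \<open>Old entries survive because \<open>core h i\<close> is closed under the new cut map.
  Conversely, the orbit of a new entry outside \<open>entries h i\<close> would avoid the entries of
  every level; then no arc on it was redirected, and it was an orbit of \<open>h\<close> all
  along.\<close>

lemma entries_act:
  assumes i: "i \<le> r"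
  shows "entries (act h \<nu>) i = entries h i"
proof
  show "entries h i \<subseteq> entries (act h \<nu>) i"
  proof
    fix v assume v: "v \<in> entries h i"
    then have vC: "v \<in> core h i" using entries_subset_core by blast
    have "i \<le> fst ((cut (act h \<nu>) i ^^ j) v)" for j
      using funpow_closed[of "core h i" "cut (act h \<nu>) i"] cut_act_in_core vC core_level by blast
    then show "v \<in> entries (act h \<nu>) i"
      using entries_D(1,2)[OF v] cut_act_periodic[OF vC] unfolding entries_def[of "act h \<nu>"] by blast
  qed
next
  let ?g = "act h \<nu>"
  show "entries ?g i \<subseteq> entries h i"
  proof
    fix v assume v: "v \<in> entries ?g i"
    show "v \<in> entries h i"
    proof (rule ccontr)
      assume nU: "v \<notin> entries h i"
      \<comment> \<open>A visit to \<open>core h i\<close> would trap the periodic orbit there, and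
        with it \<open>v\<close>.\<close>
      have avoid: "(cut ?g i ^^ j) v \<notin> core h i" for j
      proof
        assume "(cut ?g i ^^ j) v \<in> core h i"
        moreover obtain l where "(cut ?g i ^^ l) ((cut ?g i ^^ j) v) = v"
          using periodic_back entries_D(4)[OF v] by metis
        ultimately have "v \<in> core h i"
          using funpow_closed[of "core h i" "cut ?g i"] cut_act_in_core by metis
        then show False
          using core_level_eq[OF K] entries_D(2)[OF v] nU by blast
      qed
      have not_base: "(cut ?g i ^^ j) v \<noteq> base i" for j
        using avoid[of j] base_in_core[OF K i] by auto
      have gpow: "(cut ?g i ^^ j) v = (?g ^^ j) v" for j
        using not_base by (intro funpow_cong_orbit cut_other) blast
      \<comment> \<open>From an entry of a higher level \<open>j\<close> the orbit must come back to
        \<open>v\<close> on level \<open>i\<close>. By \<open>descent\<close> it passes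
        \<open>base (Suc i)\<close>, whose image lies in \<open>core h i\<close>.\<close>
      have off: "(?g ^^ a) v \<notin> entries h j" for a j
      proof
        assume u: "(?g ^^ a) v \<in> entries h j"
        have "i \<le> j"
          using entries_D(5)[OF v, of a] entries_D(2)[OF u] gpow by simp
        moreover have "i \<noteq> j"
          using u avoid[of a] entries_subset_core gpow by auto
        ultimately have ij: "i < j" by simp
        obtain k where k: "(?g ^^ k) ((?g ^^ a) v) = v"
          using periodic_back[OF entries_D(4)[OF v], of a] gpow by (metis comp_apply funpow_add)
        have "\<exists>l<k. (?g ^^ l) ((?g ^^ a) v) = base (Suc i)"
        proof (rule descent[where D = "core h" and r = r and j = j])
          show "?g y \<in> core h j" if "y \<in> core h j" "y \<noteq> base j" for j y
            using cut_act_in_core[OF that(1)] cut_other[OF that(2)] by simp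
          show "?g (base j) \<in> core h (j - 1)" if "0 < j" "j \<le> r" for j
            using act_base_drop[OF that] .
        qed (use core_level ij subsetD[OF entries_subset_core u] entries_D(3)[OF u] k entries_D(2)[OF v] in auto)
        then obtain l where "(?g ^^ l) ((?g ^^ a) v) = base (Suc i)" by blast
        then have "(?g ^^ Suc (l + a)) v = ?g (base (Suc i))"
          by (simp add: funpow_add)
        moreover have "?g (base (Suc i)) \<in> core h i"
          using act_base_drop[of "Suc i"] ij entries_D(3)[OF u] by simp
        ultimately show False
          using avoid[of "Suc (l + a)"] gpow by metis
      qed
      \<comment> \<open>An arc whose head has changed ends at an entry of some level, and the orbit
        meets none.\<close>
      have hg: "?g ((?g ^^ a) v) = h ((?g ^^ a) v)" for a
      proof (rule ccontr)
        assume ne: "?g ((?g ^^ a) v) \<noteq> h ((?g ^^ a) v)"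
        define y where "y = h ((?g ^^ a) v)"
        have g: "?g ((?g ^^ a) v) = redirect h \<nu> y" "redirect h \<nu> y \<noteq> y"
          using ne unfolding act_def[of h \<nu> "(?g ^^ a) v"] y_def by (auto split: if_splits)
        then have "y \<in> entries h (fst y)"
          using redirect_not_entries by blast
        then have "redirect h \<nu> y \<in> entries h (fst y)" by (rule redirect_in_entries)
        then show False using off[of "Suc a" "fst y"] g(1) by simp
      qed
      have hpow: "(?g ^^ j) v = (h ^^ j) v" for j
        using hg by (rule funpow_cong_orbit)
      have cpow: "(cut h i ^^ j) v = (h ^^ j) v" for j
      proof -
        have "(h ^^ j) v = (cut h i ^^ j) v"
          using not_base gpow hpow cut_other by (intro funpow_cong_orbit) metis
        then show ?thesis by simp
      qed
      have "v \<in> entries h i"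
        using entries_D[OF v] gpow hpow cpow unfolding entries_def periodic_def by auto
      then show False using nU by simp
    qed
  qed
qed

text \<open>For the harder inclusion, follow the old cut map from \<open>v\<close> to its first
  entry. Redirecting fixes all vertices on the way, so the new orbit reaches an entry as well, and
  periodicity leads from there back to \<open>v\<close>.\<close>

lemma core_act: "core (act h \<nu>) i = core h i"
proof (cases "i \<le> r")
  case False
  then show ?thesis using core_nonempty_level by blast
next
  case i: True
  let ?g = "act h \<nu>"
  show ?thesis
  proof
    show "core ?g i \<subseteq> core h i"
      using funpow_closed[of "core h i" "cut ?g i"] cut_act_in_core entries_subset_core
      unfolding core_def[of ?g] entries_act[OF i] by blast
    show "core h i \<subseteq> core ?g i"
    proof
      fix v assume v: "v \<in> core h i"
      obtain k where k: "(cut h i ^^ k) v \<in> entries h i" and min: "\<And>l. l < k \<Longrightarrow> (cut h i ^^ l) v \<notin> entries h i"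
        using core_reach_entries[OF v] exists_least_iff[of "\<lambda>k. (cut h i ^^ k) v \<in> entries h i"] by blast
      have inC: "(cut h i ^^ l) v \<in> core h i" for l
        using funpow_closed[of "core h i" "cut h i"] core_closed v by blast
      have step: "(cut ?g i ^^ l) v = (cut h i ^^ l) v" if "l < k" for l
        using that
      proof (induction l)
        case (Suc l)
        let ?x = "(cut h i ^^ Suc l) v"
        have "?x \<notin> entries h (fst ?x)"
          using min[OF Suc.prems] inC[of "Suc l"] core_disjoint[OF K] entries_subset_core by (metis subsetD)
        then have "redirect h \<nu> ?x = ?x" by (rule redirect_not_entries)
        then show ?case
          using Suc cut_act[OF inC[of l]] by simp
      qed simp
      have "\<exists>k. (cut ?g i ^^ k) v \<in> entries h i"
      proof (cases k)
        case 0
        then show ?thesis using k by (metis funpow_0)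
      next
        case (Suc l)
        then have "(cut ?g i ^^ k) v = redirect h \<nu> ((cut h i ^^ k) v)"
          using step[of l] cut_act[OF inC[of l]] by simp
        then show ?thesis using redirect_in_entries[OF k] by metis
      qed
      then obtain k where k: "(cut ?g i ^^ k) v \<in> entries ?g i"
        using entries_act[OF i] by blast
      obtain l where "(cut ?g i ^^ l) ((cut ?g i ^^ k) v) = v"
        using periodic_back[OF cut_act_periodic[OF v]] by blast
      then have "v = (cut ?g i ^^ l) ((cut ?g i ^^ k) v)" by simp
      then show "v \<in> core ?g i"
        using k unfolding core_def by blast
    qed
  qed
qed

lemma rerouted_act: "rerouted (act h \<nu>) = rerouted h"
  unfolding rerouted_def core_act ..

text \<open>By \<open>first_return_compose\<close> the new return map is the old one followed by
  \<open>redirect h \<nu>\<close>, in which the old one cancels.\<close>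

lemma return_map_act:
  assumes i: "i \<le> r"
  shows "return_map (act h \<nu>) i = \<nu> i"
proof
  fix u
  show "return_map (act h \<nu>) i u = \<nu> i u"
  proof (cases "u \<in> entries h i")
    case False
    then show ?thesis
      using \<nu>[OF i] entries_act[OF i] by (simp add: return_map_def first_return_def permutes_not_in)
  next
    case True
    have inC: "(cut h i ^^ j) v \<in> core h i" if "v \<in> entries h i" for j v
      using that unfolding core_def by blast
    have "first_return (cut (act h \<nu>) i) (entries h i) u
        = redirect h \<nu> (first_return (cut h i) (entries h i) u)"
    proof (rule first_return_compose)
      show "cut (act h \<nu>) i ((cut h i ^^ j) v) = redirect h \<nu> (cut h i ((cut h i ^^ j) v))"
        if "v \<in> entries h i" for v j
        using cut_act[OF inC[OF that]] .
      show "redirect h \<nu> ((cut h i ^^ j) v) = (cut h i ^^ j) v"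
        if v: "v \<in> entries h i" "(cut h i ^^ j) v \<notin> entries h i" for v j
        using v(2) inC[OF v(1), of j] core_disjoint[OF K] entries_subset_core
        by (intro redirect_not_entries) (metis subsetD)
    qed (use True entries_D(4) redirect_in_entries in auto)
    also have "\<dots> = redirect h \<nu> (return_map h i u)"
      unfolding return_map_def ..
    also have "\<dots> = \<nu> i u"
      using True redirect_entries[of "return_map h i u" i] permutes_in_image[OF return_map_permutes, of h i u]
        permutes_inverses(2)[OF return_map_permutes, of h i u] by simp
    finally show ?thesis
      unfolding return_map_def[of "act h \<nu>"] entries_act[OF i] .
  qed
qed

lemma admissible_act: "admissible (act h \<nu>)"
  unfolding admissible_def
proof (intro conjI allI ballI impI)
  fix v assume v: "v \<notin> V"
  then have "redirect h \<nu> v = v"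
    using redirect_permutes by (rule permutes_not_in[rotated])
  then show "act h \<nu> v = v"
    using admissible_D(1)[OF K v] unfolding act_def by simp
next
  fix v assume "v \<in> V"
  then show "act h \<nu> v \<in> V"
    using admissible_D(2)[OF K] redirect_permutes unfolding act_def by (simp add: permutes_in_image)
next
  fix v assume "v \<in> V - {base 0}"
  then show "int (fst v) - int (fst (act h \<nu> v)) \<in> S"
    using admissible_D(3)[OF K] fst_act by simp
next
  fix i assume "i \<le> r"
  then show "fst (act h \<nu> (src i)) = i" "base i \<in> entries (act h \<nu>) i"
    using admissible_D(4,5)[OF K] fst_act entries_act by simp_all
qed

text \<open>The return maps of \<open>act h \<nu>\<close> are the \<open>\<nu> i\<close>, while
  entries and rerouted arcs are those of \<open>h\<close>; so the second redirection undoes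
  \<open>\<nu>\<close> before applying \<open>\<nu>'\<close>. Taking \<open>\<nu>'\<close> to be
  \<open>return_map h\<close> therefore restores \<open>h\<close>.\<close>

lemma act_act:
  assumes \<nu>': "\<And>i. i \<le> r \<Longrightarrow> \<nu>' i permutes entries h i"
  shows "act (act h \<nu>) \<nu>' = act h \<nu>'"
proof
  fix v
  have *: "redirect (act h \<nu>) \<nu>' (redirect h \<nu> x) = redirect h \<nu>' x" for x
  proof (cases "x \<in> entries h (fst x)")
    case True
    let ?i = "fst x"
    have i: "?i \<le> r" using entries_D(3)[OF True] .
    have "redirect h \<nu> x \<in> entries (act h \<nu>) ?i"
      using redirect_in_entries[OF True] entries_act[OF i] by simp
    then have "redirect (act h \<nu>) \<nu>' (redirect h \<nu> x) = \<nu>' ?i (inv (\<nu> ?i) (redirect h \<nu> x))"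
      unfolding redirect_def[of "act h \<nu>"] fst_redirect return_map_act[OF i] by simp
    also have "\<dots> = \<nu>' ?i (inv (return_map h ?i) x)"
      using redirect_entries[OF True] permutes_inverses(2)[OF \<nu>[OF i]] by simp
    finally show ?thesis
      using True unfolding redirect_def[of h \<nu>'] by simp
  next
    case False
    have "x \<notin> entries (act h \<nu>) (fst x)"
    proof (cases "fst x \<le> r")
      case True
      then show ?thesis using False entries_act by simp
    next
      case False
      then show ?thesis using entries_D(3) by blast
    qed
    then show ?thesis
      using False redirect_not_entries[OF False] unfolding redirect_def by simp
  qed
  show "act (act h \<nu>) \<nu>' v = act h \<nu>' v"
    unfolding act_def[of "act h \<nu>"] rerouted_act by (simp add: act_def *)
qed

end

lemma act_return_map: "act h (return_map h) = h"
proof -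
  have "redirect h (return_map h) x = x" for x
    unfolding redirect_def using permutes_inverses(1)[OF return_map_permutes] by simp
  then show ?thesis
    unfolding act_def by (intro ext) simp
qed

section \<open>Exchanging fixing and cyclic return maps\<close>

definition fixing :: "(vertex \<Rightarrow> vertex) \<Rightarrow> bool" where
  "fixing h \<longleftrightarrow> admissible h \<and> (\<forall>i\<le>r. return_map h i (base i) = base i)"

definition cyclic :: "(vertex \<Rightarrow> vertex) \<Rightarrow> bool" where
  "cyclic h \<longleftrightarrow> admissible h \<and> (\<forall>i\<le>r. absorbed (return_map h i) (entries h i) (base i))"

text \<open>Every return map is replaced by its image under a bijection between the fixing and the
  cyclic permutations of \<open>entries h i\<close>. This set survives the action, so the inverse
  bijection recovers the old return maps and, by \<open>act_act\<close>, the old map.\<close>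

lemma ex_bij_fixing_cyclic:
  "\<exists>\<nu>. bij_betw (\<lambda>h. act h (\<nu> h)) {h. fixing h} {h. cyclic h} \<and>
     (\<forall>h. fixing h \<longrightarrow> (\<forall>i\<le>r. \<nu> h i permutes entries h i))"
proof -
  define Fix where "Fix X a = {p. p permutes X \<and> p a = (a::vertex)}" for X a
  define Cyc where "Cyc X a = {p. p permutes X \<and> absorbed p X (a::vertex)}" for X a
  \<comment> \<open>The choice depends only on the set and the point, so \<open>h\<close> and its
    rerouted version use the same bijection.\<close>
  define \<beta> where "\<beta> X a = (SOME \<beta>. bij_betw \<beta> (Fix X a) (Cyc X a))" for X a
  have \<beta>: "bij_betw (\<beta> X a) (Fix X a) (Cyc X a)" if "finite X" "a \<in> X" for X a
    unfolding \<beta>_def Fix_def Cyc_def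
    using ex_bij_fixing_absorbed_permutations[OF that] by (rule someI_ex)
  define \<gamma> where "\<gamma> X a = inv_into (Fix X a) (\<beta> X a)" for X a
  define \<mu> where "\<mu> h i = \<beta> (entries h i) (base i) (return_map h i)" for h i
  define \<kappa> where "\<kappa> h i = \<gamma> (entries h i) (base i) (return_map h i)" for h i
  have fixing_iff: "fixing h \<longleftrightarrow> admissible h \<and> (\<forall>i\<le>r. return_map h i \<in> Fix (entries h i) (base i))" for h
    unfolding fixing_def Fix_def using return_map_permutes by auto
  have cyclic_iff: "cyclic h \<longleftrightarrow> admissible h \<and> (\<forall>i\<le>r. return_map h i \<in> Cyc (entries h i) (base i))" for h
    unfolding cyclic_def Cyc_def using return_map_permutes by auto
  have bij: "bij_betw (\<beta> (entries h i) (base i)) (Fix (entries h i) (base i)) (Cyc (entries h i) (base i))"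
    if "admissible h" "i \<le> r" for h i
    using \<beta>[OF finite_entries] admissible_D(5)[OF that] by blast
  have \<mu>: "\<mu> h i \<in> Cyc (entries h i) (base i)" if "fixing h" "i \<le> r" for h i
    using that bij_betw_apply[OF bij] unfolding \<mu>_def fixing_iff by simp
  have \<kappa>: "\<kappa> h i \<in> Fix (entries h i) (base i)" if "cyclic h" "i \<le> r" for h i
    using that bij_betw_apply[OF bij_betw_inv_into[OF bij]] unfolding \<kappa>_def \<gamma>_def cyclic_iff by simp
  have \<mu>p: "\<mu> h i permutes entries h i" if "fixing h" "i \<le> r" for h i
    using \<mu>[OF that] unfolding Cyc_def by simp
  have \<kappa>p: "\<kappa> h i permutes entries h i" if "cyclic h" "i \<le> r" for h i
    using \<kappa>[OF that] unfolding Fix_def by simp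
  have Rp: "return_map h i permutes entries h i" if "i \<le> r" for h i by (rule return_map_permutes)
  \<comment> \<open>There are no entries above level \<open>r\<close>, so the action is determined
    by \<open>\<nu>\<close> on the levels up to \<open>r\<close>.\<close>
  have cong: "act h \<nu> = act h \<nu>'" if "\<And>i. i \<le> r \<Longrightarrow> \<nu> i = \<nu>' i" for h \<nu> \<nu>'
  proof -
    have eq: "redirect h \<nu> = redirect h \<nu>'"
      unfolding redirect_def using that entries_D(3) by fastforce
    show ?thesis unfolding act_def by (subst eq) (rule refl)
  qed
  have "bij_betw (\<lambda>h. act h (\<mu> h)) {h. fixing h} {h. cyclic h}"
  proof (rule bij_betw_byWitness[where f' = "\<lambda>h. act h (\<kappa> h)"])
    show "(\<lambda>h. act h (\<mu> h)) ` {h. fixing h} \<subseteq> {h. cyclic h}"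
    proof (rule image_subsetI)
      fix h assume "h \<in> {h. fixing h}"
      then have h: "fixing h" by simp
      then have Kh: "admissible h" by (simp add: fixing_def)
      show "act h (\<mu> h) \<in> {h. cyclic h}"
        using admissible_act[OF Kh \<mu>p[OF h]] return_map_act[OF Kh \<mu>p[OF h]] entries_act[OF Kh \<mu>p[OF h]] \<mu>[OF h]
        by (simp add: cyclic_iff)
    qed
    show "(\<lambda>h. act h (\<kappa> h)) ` {h. cyclic h} \<subseteq> {h. fixing h}"
    proof (rule image_subsetI)
      fix h assume "h \<in> {h. cyclic h}"
      then have h: "cyclic h" by simp
      then have Kh: "admissible h" by (simp add: cyclic_def)
      show "act h (\<kappa> h) \<in> {h. fixing h}"
        using admissible_act[OF Kh \<kappa>p[OF h]] return_map_act[OF Kh \<kappa>p[OF h]] entries_act[OF Kh \<kappa>p[OF h]] \<kappa>[OF h]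
        by (simp add: fixing_iff)
    qed
    show "\<forall>h\<in>{h. fixing h}. act (act h (\<mu> h)) (\<kappa> (act h (\<mu> h))) = h"
    proof
      fix h assume "h \<in> {h. fixing h}"
      then have h: "fixing h" by simp
      then have Kh: "admissible h" by (simp add: fixing_def)
      have a: "return_map (act h (\<mu> h)) i = \<mu> h i" "entries (act h (\<mu> h)) i = entries h i" if "i \<le> r" for i
        using return_map_act[OF Kh \<mu>p[OF h]] entries_act[OF Kh \<mu>p[OF h]] that by simp_all
      have "\<kappa> (act h (\<mu> h)) i = return_map h i" if "i \<le> r" for i
        unfolding \<kappa>_def a[OF that] \<mu>_def \<gamma>_def
        using bij_betw_inv_into_left[OF bij[OF Kh that]] h that unfolding fixing_iff by simp
      then have "act (act h (\<mu> h)) (\<kappa> (act h (\<mu> h))) = act (act h (\<mu> h)) (return_map h)"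
        by (rule cong)
      also have "\<dots> = act h (return_map h)"
        using act_act[OF Kh \<mu>p[OF h] Rp] by simp
      finally show "act (act h (\<mu> h)) (\<kappa> (act h (\<mu> h))) = h"
        by (simp add: act_return_map)
    qed
    show "\<forall>h\<in>{h. cyclic h}. act (act h (\<kappa> h)) (\<mu> (act h (\<kappa> h))) = h"
    proof
      fix h assume "h \<in> {h. cyclic h}"
      then have h: "cyclic h" by simp
      then have Kh: "admissible h" by (simp add: cyclic_def)
      have a: "return_map (act h (\<kappa> h)) i = \<kappa> h i" "entries (act h (\<kappa> h)) i = entries h i" if "i \<le> r" for i
        using return_map_act[OF Kh \<kappa>p[OF h]] entries_act[OF Kh \<kappa>p[OF h]] that by simp_all
      have "\<mu> (act h (\<kappa> h)) i = return_map h i" if "i \<le> r" for i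
        unfolding \<mu>_def a[OF that] \<kappa>_def \<gamma>_def
        using bij_betw_inv_into_right[OF bij[OF Kh that]] h that unfolding cyclic_iff by simp
      then have "act (act h (\<kappa> h)) (\<mu> (act h (\<kappa> h))) = act (act h (\<kappa> h)) (return_map h)"
        by (rule cong)
      also have "\<dots> = act h (return_map h)"
        using act_act[OF Kh \<kappa>p[OF h] Rp] by simp
      finally show "act (act h (\<kappa> h)) (\<mu> (act h (\<kappa> h))) = h"
        by (simp add: act_return_map)
    qed
  qed
  then show ?thesis using \<mu>p by blast
qed

subsection \<open>Functions satisfying (F)\<close>

definition par :: "(vertex \<Rightarrow> vertex) \<Rightarrow> vertex \<rightharpoonup> vertex" where
  "par h v = (if v \<in> V - {base 0} then Some (h v) else None)"

text \<open>The vertex \<open>x\<close> is the head of the extra arc leaving \<open>base 0\<close>: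
  it will be \<open>base r\<close> for a function and the marked vertex for a tree.\<close>

definition tot :: "(vertex \<rightharpoonup> vertex) \<Rightarrow> vertex \<Rightarrow> vertex \<Rightarrow> vertex" where
  "tot f x v = (if v = base 0 then x else case f v of Some w \<Rightarrow> w | None \<Rightarrow> v)"

definition steps :: "(vertex \<Rightarrow> vertex) \<Rightarrow> bool" where
  "steps h \<longleftrightarrow> (\<forall>v. v \<notin> V \<longrightarrow> h v = v) \<and> (\<forall>v\<in>V. h v \<in> V) \<and>
    (\<forall>v\<in>V - {base 0}. int (fst v) - int (fst (h v)) \<in> S)"

lemma admissible_iff: "admissible h \<longleftrightarrow> steps h \<and> (\<forall>i\<le>r. fst (h (src i)) = i \<and> base i \<in> entries h i)"
  unfolding admissible_def steps_def by blast

text \<open>The cut map sends \<open>base i\<close> to \<open>h (src i)\<close>, which is itself an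
  entry, so the return takes one step.\<close>

lemma return_map_base:
  assumes "admissible h" "i \<le> r"
  shows "return_map h i (base i) = h (src i)"
proof -
  have "return_time (cut h i) (entries h i) (base i) = 1"
    unfolding return_time_def using h_src_in_entries[OF assms]
    by (intro Least_equality) (auto simp: cut_base)
  then show ?thesis
    using admissible_D(5)[OF assms] unfolding return_map_def first_return_def by (simp add: cut_base)
qed

text \<open>One direction is \<open>return_map_base\<close>. Conversely,
  \<open>h (src i) = base i\<close> makes \<open>base i\<close> a fixed point of
  \<open>cut h i\<close> and so an entry: all excursions are trivial.\<close>

lemma fixing_iff: "fixing h \<longleftrightarrow> steps h \<and> (\<forall>i\<le>r. h (src i) = base i)"
proof
  assume "fixing h"
  then show "steps h \<and> (\<forall>i\<le>r. h (src i) = base i)"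
    using return_map_base unfolding fixing_def admissible_iff by auto
next
  assume h: "steps h \<and> (\<forall>i\<le>r. h (src i) = base i)"
  have "base i \<in> entries h i" if "i \<le> r" for i
  proof -
    have "cut h i (base i) = base i"
      using h that by (simp add: cut_base)
    then have "(cut h i ^^ j) (base i) = base i" for j
      by (induction j) auto
    then show ?thesis
      using base_in_V[OF that] unfolding entries_def periodic_def by auto
  qed
  then have "admissible h"
    using h unfolding admissible_iff by simp
  then show "fixing h"
    using h return_map_base unfolding fixing_def by simp
qed

lemma in_layers_iff:
  "w \<in> (\<Union>s\<in>S. layer n r (abscissa v - s)) \<longleftrightarrow> w \<in> V \<and> int (fst v) - int (fst w) \<in> S"
proof -
  have "int (fst w) = int (fst v) - s \<longleftrightarrow> s = int (fst v) - int (fst w)" for s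
    by auto
  then show ?thesis
    unfolding layer_def abscissa_def by auto
qed

lemma par_tot:
  assumes "dom f = V - {base 0}"
  shows "par (tot f x) = f"
proof
  fix v
  show "par (tot f x) v = f v"
    using assms unfolding par_def tot_def by (auto simp: domIff split: option.split)
qed

lemma tot_par:
  assumes "\<And>v. v \<notin> V \<Longrightarrow> h v = v"
  shows "tot (par h) (h (base 0)) = h"
  using assms unfolding par_def tot_def by auto

lemma steps_tot:
  assumes dom: "dom f = V - {base 0}" and x: "x \<in> V"
    and step: "\<And>v w. f v = Some w \<Longrightarrow> w \<in> (\<Union>s\<in>S. layer n r (abscissa v - s))"
  shows "steps (tot f x)"
  unfolding steps_def
proof (intro conjI allI ballI impI)
  fix v assume "v \<notin> V"
  then have "v \<noteq> base 0" "f v = None"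
    using base_in_V[of 0] dom by (auto simp: domIff)
  then show "tot f x v = v"
    unfolding tot_def by simp
next
  fix v assume v: "v \<in> V - {base 0}"
  then obtain w where w: "f v = Some w"
    using dom by blast
  then show "int (fst v) - int (fst (tot f x v)) \<in> S"
    using step[OF w] v unfolding in_layers_iff tot_def by simp
next
  fix v assume v: "v \<in> V"
  show "tot f x v \<in> V"
  proof (cases "v = base 0")
    case False
    then obtain w where w: "f v = Some w"
      using dom v by blast
    then show ?thesis
      using step[OF w] False unfolding in_layers_iff tot_def by simp
  qed (simp add: tot_def x)
qed

lemma par_S_function:
  assumes "steps h"
  shows "S_function n r S (par h)" "dom (par h) = V - {base 0}"
proof -
  show dom: "dom (par h) = V - {base 0}"
    unfolding par_def dom_def by auto
  have "w \<in> V \<and> int (fst v) - int (fst w) \<in> S" if "par h v = Some w" for v w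
  proof -
    have "v \<in> V - {base 0}" "w = h v"
      using that unfolding par_def by (auto split: if_splits)
    then show ?thesis
      using assms unfolding steps_def by blast
  qed
  then show "S_function n r S (par h)"
    unfolding S_function_def in_layers_iff dom by blast
qed

text \<open>For \<open>i < r\<close> the right-hand side is the instance of (F) at
  \<open>i + 1\<close>. For \<open>i = r\<close> it concerns the extra arc, which \<open>tot\<close>
  directs to \<open>base r\<close>.\<close>

lemma condition_F_iff:
  assumes "dom f = V - {base 0}"
  shows "condition_F r f \<longleftrightarrow> (\<forall>i\<le>r. tot f (base r) (src i) = base i)"
proof
  assume F: "condition_F r f"
  show "\<forall>i\<le>r. tot f (base r) (src i) = base i"
  proof (intro allI impI)
    fix i assume i: "i \<le> r"
    show "tot f (base r) (src i) = base i"
    proof (cases "i = r")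
      case False
      then have "f (base (Suc i)) = Some (base i)"
        using F i unfolding condition_F_def base_def by force
      then show ?thesis
        using False unfolding src_def tot_def by simp
    qed (simp add: src_def tot_def)
  qed
next
  assume F: "\<forall>i\<le>r. tot f (base r) (src i) = base i"
  show "condition_F r f"
    unfolding condition_F_def
  proof
    fix i assume i: "i \<in> {1..r}"
    then have "tot f (base r) (base i) = base (i - 1)"
      using F[rule_format, of "i - 1"] src_less[of i] by auto
    moreover have "base i \<in> dom f" "base i \<noteq> base 0"
      using assms i base_in_V[of i] by auto
    ultimately have "f (base i) = Some (base (i - 1))"
      unfolding tot_def by (auto split: option.splits)
    then show "f (i, 1) = Some (i - 1, 1)"
      unfolding base_def .
  qed
qed

lemma bij_tot:
  "bij_betw (\<lambda>f. tot f (base r))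
    {f. S_function n r S f \<and> dom f = V - {base 0} \<and> condition_F r f} {h. fixing h}"
proof (rule bij_betw_byWitness[where f' = par])
  show "\<forall>f\<in>{f. S_function n r S f \<and> dom f = V - {base 0} \<and> condition_F r f}.
      par (tot f (base r)) = f"
    using par_tot by blast
  have fixing_tot: "tot (par h) (base r) = h" if "fixing h" for h
  proof -
    have "h (src r) = base r" "\<And>v. v \<notin> V \<Longrightarrow> h v = v"
      using that unfolding fixing_iff steps_def by auto
    then show ?thesis
      using tot_par[of h] by (simp add: src_def)
  qed
  then show "\<forall>h\<in>{h. fixing h}. tot (par h) (base r) = h"
    by blast
  show "(\<lambda>f. tot f (base r)) ` {f. S_function n r S f \<and> dom f = V - {base 0} \<and> condition_F r f}
      \<subseteq> {h. fixing h}"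
  proof (rule image_subsetI)
    fix f assume "f \<in> {f. S_function n r S f \<and> dom f = V - {base 0} \<and> condition_F r f}"
    then have f: "S_function n r S f" "dom f = V - {base 0}" "condition_F r f" by auto
    have "steps (tot f (base r))"
      using f(1) base_in_V[of r] unfolding S_function_def by (intro steps_tot[OF f(2)]) auto
    then show "tot f (base r) \<in> {h. fixing h}"
      using f(3) condition_F_iff[OF f(2)] unfolding fixing_iff by simp
  qed
  show "par ` {h. fixing h} \<subseteq> {f. S_function n r S f \<and> dom f = V - {base 0} \<and> condition_F r f}"
  proof (rule image_subsetI)
    fix h assume "h \<in> {h. fixing h}"
    then have h: "fixing h" by simp
    then have s: "steps h" unfolding fixing_iff by simp
    have "condition_F r (par h)"
      unfolding condition_F_iff[OF par_S_function(2)[OF s]] fixing_tot[OF h]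
      using h unfolding fixing_iff by simp
    then show "par h \<in> {f. S_function n r S f \<and> dom f = V - {base 0} \<and> condition_F r f}"
      using par_S_function[OF s] by simp
  qed
qed

subsection \<open>Marked trees satisfying (T)\<close>

text \<open>The time \<open>k\<close> may be any visit to \<open>base i\<close>, not only the first,
  so that passages can be shifted and concatenated.\<close>

definition passage :: "(vertex \<Rightarrow> vertex) \<Rightarrow> nat \<Rightarrow> vertex \<Rightarrow> bool" where
  "passage h i x \<longleftrightarrow> (\<exists>k. (h ^^ k) x = base i \<and> (\<forall>j\<le>k. i \<le> fst ((h ^^ j) x)))"

text \<open>The cut map starts at \<open>base i\<close> with the jump to \<open>h (src i)\<close>
  and otherwise agrees with \<open>h\<close>. Its orbit closes up at levels \<open>\<ge> i\<close>
  exactly if the \<open>h\<close>-orbit from there comes to \<open>base i\<close> within these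
  levels.\<close>

lemma base_in_entries_iff:
  assumes i: "i \<le> r"
  shows "base i \<in> entries h i \<longleftrightarrow> passage h i (h (src i))"
proof
  let ?x = "h (src i)"
  have Suc: "(cut h i ^^ Suc j) (base i) = (cut h i ^^ j) ?x" for j
    by (simp add: funpow_swap1 cut_base)
  assume U: "base i \<in> entries h i"
  then obtain m where "0 < m \<and> (cut h i ^^ m) (base i) = base i"
    using entries_D(4)[OF U] unfolding periodic_def by blast
  then obtain m where m: "0 < m" "(cut h i ^^ m) (base i) = base i"
    and min: "\<And>l. 0 < l \<Longrightarrow> l < m \<Longrightarrow> (cut h i ^^ l) (base i) \<noteq> base i"
    using exists_least_iff[of "\<lambda>m. 0 < m \<and> (cut h i ^^ m) (base i) = base i"] by blast
  obtain k where k: "m = Suc k" using m(1) gr0_conv_Suc by auto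
  have eq: "(cut h i ^^ j) ?x = (h ^^ j) ?x" if "j \<le> k" for j
  proof (rule funpow_cong_orbit, rule cut_other)
    fix l assume "l < j"
    then show "(cut h i ^^ l) ?x \<noteq> base i"
      using min[of "Suc l"] that k unfolding Suc by linarith
  qed
  have "(h ^^ k) ?x = base i"
  proof -
    have "(cut h i ^^ k) ?x = base i"
      using m(2) unfolding k by (simp only: Suc)
    then show ?thesis using eq[of k] by simp
  qed
  moreover have "i \<le> fst ((h ^^ j) ?x)" if "j \<le> k" for j
    using entries_D(5)[OF U, of "Suc j"] by (simp only: Suc eq[OF that])
  ultimately show "passage h i ?x"
    unfolding passage_def by blast
next
  let ?x = "h (src i)"
  assume "passage h i ?x"
  then obtain k0 where k0: "(h ^^ k0) ?x = base i" "\<And>j. j \<le> k0 \<Longrightarrow> i \<le> fst ((h ^^ j) ?x)"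
    unfolding passage_def by blast
  obtain k where k: "(h ^^ k) ?x = base i" and min: "\<And>l. l < k \<Longrightarrow> (h ^^ l) ?x \<noteq> base i"
    using k0(1) exists_least_iff[of "\<lambda>k. (h ^^ k) ?x = base i"] by blast
  have "k \<le> k0" using min k0(1) not_le by blast
  have eq: "(cut h i ^^ j) ?x = (h ^^ j) ?x" if "j \<le> k" for j
  proof -
    have "(h ^^ j) ?x = (cut h i ^^ j) ?x"
    proof (rule funpow_cong_orbit)
      fix l assume "l < j"
      then show "h ((h ^^ l) ?x) = cut h i ((h ^^ l) ?x)"
        using min[of l] that by (intro cut_other[symmetric]) simp
    qed
    then show ?thesis by simp
  qed
  \<comment> \<open>The \<open>h\<close>-orbit up to its first visit to \<open>base i\<close>; it is
    closed under the cut map, which jumps from \<open>base i\<close> back to its start.\<close>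
  define W where "W = (\<lambda>j. (h ^^ j) ?x) ` {..k}"
  have closed: "cut h i y \<in> W" if y: "y \<in> W" for y
  proof -
    obtain j where j: "j \<le> k" "y = (h ^^ j) ?x"
      using y unfolding W_def by blast
    show ?thesis
    proof (cases "j = k")
      case True
      then have "cut h i y = (h ^^ 0) ?x"
        using j k by (simp add: cut_base)
      then show ?thesis unfolding W_def by blast
    next
      case False
      then have "cut h i y = (h ^^ Suc j) ?x"
        using min[of j] j by (simp add: cut_other)
      moreover have "Suc j \<in> {..k}" using False j(1) by simp
      ultimately show ?thesis unfolding W_def by blast
    qed
  qed
  have base: "base i \<in> W"
    using k unfolding W_def by (intro image_eqI[of _ _ k]) auto
  have "i \<le> fst y" if "y \<in> W" for y
    using that k0(2) \<open>k \<le> k0\<close> unfolding W_def by auto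
  then have "i \<le> fst ((cut h i ^^ j) (base i))" for j
    using funpow_closed[of W "cut h i", OF closed base] by blast
  moreover have "(cut h i ^^ Suc k) (base i) = base i"
    using eq[of k] k by (simp add: funpow_swap1 cut_base)
  then have "periodic (cut h i) (base i)"
    unfolding periodic_def by blast
  ultimately show "base i \<in> entries h i"
    using base_in_V[OF i] unfolding entries_def by simp
qed

definition tree_like :: "(vertex \<Rightarrow> vertex) \<Rightarrow> bool" where
  "tree_like h \<longleftrightarrow> steps h \<and> fst (h (base 0)) = r \<and> (\<forall>v\<in>V. \<exists>k. (h ^^ k) v = base 0) \<and>
    (\<forall>i\<in>{1..r}. passage h i (h (base 0)) \<and> fst (h (base i)) = i - 1)"

text \<open>For \<open>i < r\<close> the excursion of level \<open>i\<close> is what remains of the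
  passage to \<open>base i\<close> after \<open>base (Suc i)\<close>. As to absorption, an entry
  whose cut orbit missed \<open>base i\<close> would follow \<open>h\<close> to the root; this
  forces \<open>i = 0\<close>, where the root is \<open>base i\<close>.\<close>

lemma tree_like_imp_cyclic:
  assumes "tree_like h"
  shows "cyclic h"
proof -
  let ?x = "h (base 0)"
  have s: "steps h" and x: "fst ?x = r" and reach: "\<And>v. v \<in> V \<Longrightarrow> \<exists>k. (h ^^ k) v = base 0"
    and T: "\<And>i. 1 \<le> i \<Longrightarrow> i \<le> r \<Longrightarrow> passage h i ?x \<and> fst (h (base i)) = i - 1"
    using assms unfolding tree_like_def by auto
  have xV: "?x \<in> V"
    using s base_in_V[of 0] unfolding steps_def by simp
  have pass: "passage h i ?x" if "i \<le> r" for i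
  proof (cases "i = 0")
    case True
    then show ?thesis
      using reach[OF xV] unfolding passage_def by auto
  qed (use T that in simp)
  have "base i \<in> entries h i" if i: "i \<le> r" for i
  proof -
    have "passage h i (h (src i))"
    proof (cases "i = r")
      case True
      then show ?thesis using pass[OF i] unfolding src_def by simp
    next
      case False
      obtain k1 where k1: "(h ^^ k1) ?x = base (Suc i)" "\<And>j. j \<le> k1 \<Longrightarrow> Suc i \<le> fst ((h ^^ j) ?x)"
        using pass[of "Suc i"] False i unfolding passage_def by auto
      obtain k where k: "(h ^^ k) ?x = base i" "\<And>j. j \<le> k \<Longrightarrow> i \<le> fst ((h ^^ j) ?x)"
        using pass[OF i] unfolding passage_def by auto
      \<comment> \<open>Up to time \<open>k1\<close> the levels are at least \<open>Suc i\<close>,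
        so \<open>base i\<close> comes later.\<close>
      have "k1 < k"
        using k1(2)[of k] k(1) by (cases "k \<le> k1") auto
      have shift: "(h ^^ j) (h (src i)) = (h ^^ (j + Suc k1)) ?x" for j
        using False k1(1) unfolding src_def by (simp add: funpow_add del: add_Suc_right)
      have "(h ^^ (k - Suc k1)) (h (src i)) = base i"
        using shift[of "k - Suc k1"] k(1) \<open>k1 < k\<close> by simp
      moreover have "i \<le> fst ((h ^^ j) (h (src i)))" if "j \<le> k - Suc k1" for j
        using k(2)[of "j + Suc k1"] shift[of j] that \<open>k1 < k\<close> by simp
      ultimately show ?thesis
        unfolding passage_def by blast
    qed
    then show ?thesis using base_in_entries_iff[OF i] by blast
  qed
  moreover have "fst (h (src i)) = i" if "i \<le> r" for i
    using x T[of "Suc i"] that unfolding src_def by auto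
  ultimately have K: "admissible h"
    using s unfolding admissible_iff by blast
  have "absorbed (return_map h i) (entries h i) (base i)" if i: "i \<le> r" for i
  proof -
    have "absorbed (cut h i) (entries h i) (base i)"
      unfolding absorbed_def
    proof (rule ballI, rule ccontr)
      fix v assume v: "v \<in> entries h i" and no: "\<nexists>k. (cut h i ^^ k) v = base i"
      have eq: "(cut h i ^^ k) v = (h ^^ k) v" for k
        using no by (intro funpow_cong_orbit cut_other) blast
      obtain k where "(h ^^ k) v = base 0"
        using reach entries_D(1)[OF v] by blast
      then have "(cut h i ^^ k) v = base 0" "i = 0"
        using eq[of k] entries_D(5)[OF v, of k] by auto
      then show False using no by blast
    qed
    then show ?thesis
      unfolding return_map_def using first_return_absorbed[OF entries_D(4) admissible_D(5)[OF K i]] by blast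
  qed
  then show ?thesis
    using K unfolding cyclic_def by simp
qed

text \<open>An orbit missing the root ends in a cycle of \<open>h\<close>. A vertex of lowest level
  \<open>i\<close> on this cycle is an entry, but the cycle avoids \<open>base i\<close>, contrary
  to absorption.\<close>

lemma cyclic_reach:
  assumes "cyclic h" and v: "v \<in> V"
  shows "\<exists>k. (h ^^ k) v = base 0"
proof (rule ccontr)
  assume no: "\<not> ?thesis"
  have K: "admissible h" and abs: "\<And>i. i \<le> r \<Longrightarrow> absorbed (return_map h i) (entries h i) (base i)"
    using assms(1) unfolding cyclic_def by auto
  have inV: "(h ^^ k) v \<in> V" for k
    using funpow_closed[of V h] admissible_D(2)[OF K] v by blast
  then have "range (\<lambda>k. (h ^^ k) v) \<subseteq> V" by blast
  then have "\<not> inj (\<lambda>k. (h ^^ k) v)"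
    using finite_V finite_imageD[of "\<lambda>k. (h ^^ k) v" UNIV] finite_subset by blast
  then obtain a b where ab: "(h ^^ a) v = (h ^^ b) v" "a < b"
    by (metis (mono_tags, lifting) injI linorder_neqE_nat)
  define w where "w = (h ^^ a) v"
  have "(h ^^ (b - a)) w = w"
    using ab unfolding w_def by (metis comp_apply funpow_add le_add_diff_inverse2 less_imp_le_nat)
  then have per: "periodic h w"
    using ab(2) unfolding periodic_def by (intro exI[of _ "b - a"]) simp
  define i where "i = (LEAST l. \<exists>k. fst ((h ^^ k) w) = l)"
  have "\<exists>l k. fst ((h ^^ k) w) = l" by blast
  then have "\<exists>k. fst ((h ^^ k) w) = i"
    unfolding i_def by (rule LeastI_ex)
  then obtain k where k: "fst ((h ^^ k) w) = i" by blast
  define z where "z = (h ^^ k) w"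
  have zk: "(h ^^ l) z = (h ^^ (l + k)) w" for l
    unfolding z_def by (simp add: funpow_add)
  have z_v: "(h ^^ l) z = (h ^^ (l + k + a)) v" for l
    unfolding zk w_def by (simp add: funpow_add)
  have min: "i \<le> fst ((h ^^ l) z)" for l
    unfolding zk i_def by (rule Least_le) blast
  have zV: "z \<in> V"
    using z_v[of 0] inV by simp
  then have i: "i \<le> r"
    using fst_le k unfolding z_def by blast
  \<comment> \<open>For \<open>i = 0\<close> this vertex would be the root; for \<open>i > 0\<close>
    its arc drops below the minimal level of the cycle.\<close>
  have avoid: "(h ^^ l) z \<noteq> base i" for l
  proof
    assume l: "(h ^^ l) z = base i"
    show False
    proof (cases "i = 0")
      case True
      then show False using l no z_v[of l] by metis
    next
      case False
      then have "fst (h (base i)) = i - 1"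
        using h_base_drop[OF K, of i] i entries_D(2) by simp
      then show False
        using min[of "Suc l"] l False by simp
    qed
  qed
  have eq: "(cut h i ^^ l) z = (h ^^ l) z" for l
  proof -
    have "(h ^^ l) z = (cut h i ^^ l) z"
      using avoid by (intro funpow_cong_orbit cut_other[symmetric])
    then show ?thesis by simp
  qed
  have "periodic h z"
    unfolding z_def using per by (rule periodic_funpow)
  moreover have "fst z = i"
    using k unfolding z_def .
  ultimately have "z \<in> entries h i"
    using zV min unfolding entries_def periodic_def by (simp add: eq)
  moreover have "absorbed (cut h i) (entries h i) (base i)"
    using abs[OF i] first_return_absorbed[OF entries_D(4) admissible_D(5)[OF K i]] unfolding return_map_def by blast
  ultimately show False
    using avoid eq unfolding absorbed_def by metis
qed

text \<open>The excursions of levels \<open>r\<close>, \<open>r - 1\<close>, ... are concatenated,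
  since each one is opened by the arc leaving the base vertex at which the preceding one
  ends.\<close>

lemma cyclic_imp_tree_like:
  assumes "cyclic h"
  shows "tree_like h"
proof -
  let ?x = "h (base 0)"
  have K: "admissible h"
    using assms unfolding cyclic_def by simp
  have loc: "passage h i (h (src i))" if "i \<le> r" for i
    using base_in_entries_iff[OF that] admissible_D(5)[OF K that] by blast
  have "passage h i ?x" if "i \<le> r" for i
    using that
  proof (induction rule: inc_induct)
    case base
    then show ?case using loc[of r] unfolding src_def by simp
  next
    case (step i)
    obtain k1 where k1: "(h ^^ k1) ?x = base (Suc i)" "\<And>j. j \<le> k1 \<Longrightarrow> Suc i \<le> fst ((h ^^ j) ?x)"
      using step.IH unfolding passage_def by auto
    obtain k2 where k2: "(h ^^ k2) (h (src i)) = base i" "\<And>j. j \<le> k2 \<Longrightarrow> i \<le> fst ((h ^^ j) (h (src i)))"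
      using loc[of i] step.hyps unfolding passage_def by auto
    have shift: "(h ^^ j) (h (src i)) = (h ^^ (j + Suc k1)) ?x" for j
      using step.hyps k1(1) unfolding src_def by (simp add: funpow_add del: add_Suc_right)
    have "i \<le> fst ((h ^^ j) ?x)" if "j \<le> k2 + Suc k1" for j
    proof (cases "j \<le> k1")
      case True
      then show ?thesis using k1(2)[of j] by simp
    next
      case False
      then show ?thesis
        using k2(2)[of "j - Suc k1"] shift[of "j - Suc k1"] that by simp
    qed
    then show ?case
      using k2(1) unfolding passage_def shift by blast
  qed
  moreover have "fst (h (base i)) = i - 1" if "i \<in> {1..r}" for i
    using h_base_drop[OF K, of i] that entries_D(2) by simp
  moreover have "fst ?x = r"
    using admissible_D(4)[OF K, of r] unfolding src_def by simp
  ultimately show ?thesis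
    using K cyclic_reach[OF assms] unfolding tree_like_def admissible_iff by simp
qed

lemma cyclic_iff_tree_like: "cyclic h \<longleftrightarrow> tree_like h"
  using cyclic_imp_tree_like tree_like_imp_cyclic by blast

text \<open>The path starts at level \<open>r\<close> and never falls by more than one level per
  step, so having avoided level \<open>i - 1\<close> means having stayed at levels
  \<open>\<ge> i\<close>.\<close>

lemma condition_T_iff:
  assumes rm: "rooted_map V (base 0) h" and s: "steps h" and x: "x \<in> V" "fst x = r"
  shows "condition_T n r (0, 1) (map_edges V (base 0) h, x) \<longleftrightarrow>
    (\<forall>i\<in>{1..r}. passage h i x \<and> fst (h (base i)) = i - 1)"
proof -
  interpret rooted_map V "base 0" h by (rule rm)
  have base0: "(0, 1) = base 0" by (simp add: base_def)
  have path: "tree_path V (map_edges V (base 0) h) x (base 0) = walk x"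
    using tree_path_eq_walk x(1) .
  have nth: "walk x ! j = (h ^^ j) x" if "j \<le> depth x" for j
    using that unfolding walk_def by (simp del: upt_Suc)
  have len: "length (walk x) = Suc (depth x)"
    unfolding walk_def by simp
  have inV: "(h ^^ j) x \<in> V" for j
    using funpow_closed[of V h] s x(1) unfolding steps_def by blast
  have depth: "(h ^^ depth x) x = base 0"
    unfolding depth_def using reach[OF x(1)] by (rule LeastI_ex)
  have before: "(h ^^ j) x \<noteq> base 0" if "j < depth x" for j
    using that not_less_Least unfolding depth_def by blast
  have layer: "y \<in> layer n r (int i - 1) \<longleftrightarrow> y \<in> V \<and> fst y = i - 1" if "1 \<le> i" for y i
    using that unfolding layer_def abscissa_def by auto
  show ?thesis
    unfolding condition_T_def prod.case base0 path
  proof (intro ball_cong refl)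
    fix i assume i: "i \<in> {1..r}"
    then have i1: "1 \<le> i" "i \<le> r" by auto
    show "(\<exists>xs w ys. walk x = xs @ [(i, 1), w] @ ys \<and> w \<in> layer n r (int i - 1) \<and>
        (\<forall>y\<in>set (xs @ [(i, 1)]). y \<notin> layer n r (int i - 1))) \<longleftrightarrow>
      passage h i x \<and> fst (h (base i)) = i - 1"
    proof
      assume "passage h i x \<and> fst (h (base i)) = i - 1"
      then obtain k where k: "(h ^^ k) x = base i" "\<And>j. j \<le> k \<Longrightarrow> i \<le> fst ((h ^^ j) x)"
        and drop: "fst (h (base i)) = i - 1"
        unfolding passage_def by blast
      \<comment> \<open>The root has level 0, below \<open>i\<close>, so it comes after time
        \<open>k\<close>.\<close>
      have "k < depth x"
        using k(2)[of "depth x"] depth i1 by (cases "depth x \<le> k") auto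
      then have "walk x = take k (walk x) @ walk x ! k # walk x ! Suc k # drop (Suc (Suc k)) (walk x)"
        using len by (metis Cons_nth_drop_Suc Suc_mono append_take_drop_id less_SucI)
      moreover have "walk x ! k = (i, 1)"
        using nth[of k] k(1) \<open>k < depth x\<close> by (simp add: base_def)
      moreover have "walk x ! Suc k = h (base i)"
        using nth[of "Suc k"] k(1) \<open>k < depth x\<close> by simp
      ultimately have "walk x = take k (walk x) @ [(i, 1), h (base i)] @ drop (Suc (Suc k)) (walk x)"
        by simp
      moreover have "h (base i) \<in> layer n r (int i - 1)"
        unfolding layer[OF i1(1)] using drop inV[of "Suc k"] k(1) by simp
      moreover have "y \<notin> layer n r (int i - 1)" if y: "y \<in> set (take k (walk x) @ [(i, 1)])" for y
      proof -
        have "i \<le> fst y"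
        proof (cases "y = (i, 1)")
          case False
          then obtain j where "j < k" "y = walk x ! j"
            using y by (auto simp: in_set_conv_nth)
          then show ?thesis
            using k(2)[of j] nth[of j] \<open>k < depth x\<close> by simp
        qed simp
        then show ?thesis
          using i1(1) unfolding layer[OF i1(1)] by auto
      qed
      ultimately show "\<exists>xs w ys. walk x = xs @ [(i, 1), w] @ ys \<and> w \<in> layer n r (int i - 1) \<and>
        (\<forall>y\<in>set (xs @ [(i, 1)]). y \<notin> layer n r (int i - 1))"
        by blast
    next
      assume "\<exists>xs w ys. walk x = xs @ [(i, 1), w] @ ys \<and> w \<in> layer n r (int i - 1) \<and>
        (\<forall>y\<in>set (xs @ [(i, 1)]). y \<notin> layer n r (int i - 1))"
      then obtain xs w ys where xs: "walk x = xs @ [(i, 1), w] @ ys" "w \<in> layer n r (int i - 1)"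
        "\<And>y. y \<in> set (xs @ [(i, 1)]) \<Longrightarrow> y \<notin> layer n r (int i - 1)"
        by blast
      define k where "k = length xs"
      have k: "Suc k \<le> depth x"
        using len unfolding xs(1) k_def by simp
      have hk: "(h ^^ k) x = base i"
        using nth[of k] k unfolding xs(1) k_def by (simp add: base_def)
      have hSk: "h (base i) = w"
        using nth[of "Suc k"] k hk unfolding xs(1) k_def by (simp add: nth_append)
      have off: "fst ((h ^^ j) x) \<noteq> i - 1" if "j \<le> k" for j
      proof -
        have "walk x ! j = (xs @ [(i, 1)]) ! j"
          using that unfolding xs(1) k_def by (auto simp: nth_append)
        then have "(h ^^ j) x \<in> set (xs @ [(i, 1)])"
          using nth[of j] that k unfolding k_def by (metis Suc_leD le_imp_less_Suc le_trans
              length_append_singleton nth_mem)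
        then show ?thesis
          using xs(3) inV layer[OF i1(1)] by blast
      qed
      have "i \<le> fst ((h ^^ j) x)" if "j \<le> k" for j
        using that
      proof (induction j)
        case 0
        then show ?case using x(2) i1 by simp
      next
        case (Suc j)
        let ?y = "(h ^^ j) x"
        \<comment> \<open>The step bound holds away from the root only, and the root has not been
          reached yet.\<close>
        have "?y \<in> V - {base 0}"
          using inV[of j] before[of j] Suc.prems k by simp
        then have "int (fst ?y) - int (fst (h ?y)) \<le> 1"
          using s S_le_1 unfolding steps_def by blast
        then show ?case
          using Suc off[OF Suc.prems] by simp
      qed
      then have "passage h i x"
        using hk unfolding passage_def by blast
      then show "passage h i x \<and> fst (h (base i)) = i - 1"
        using xs(2) hSk layer[OF i1(1)] by blast
    qed
  qed
qed

lemma steps_rooted_map: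
  assumes "steps h" "\<forall>v\<in>V. \<exists>k. (h ^^ k) v = base 0"
  shows "rooted_map V (base 0) h"
  using assms base_in_V[of 0] unfolding steps_def by unfold_locales auto

lemma parent_map_edges:
  assumes "steps h" "\<forall>v\<in>V. \<exists>k. (h ^^ k) v = base 0"
  shows "parent_map V (map_edges V (base 0) h) (base 0) = par h"
  using rooted_map.parent_map_map_edges[OF steps_rooted_map[OF assms]] unfolding par_def .

text \<open>The value at the root stores the marked vertex and the other values form the parent map;
  \<open>tot\<close> puts the two together again.\<close>

lemma bij_encode:
  "bij_betw (\<lambda>h. (map_edges V (base 0) h, h (base 0))) {h. tree_like h}
    {T. marked_S_tree n r S (0, 1) T \<and> condition_T n r (0, 1) T}"
  (is "bij_betw ?enc _ ?T")
proof (rule bij_betw_byWitness[where f' = "\<lambda>(E, x). tot (parent_map V E (base 0)) x"])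
  have base0: "(0, 1) = base 0" by (simp add: base_def)
  show "\<forall>h\<in>{h. tree_like h}. (\<lambda>(E, x). tot (parent_map V E (base 0)) x) (?enc h) = h"
  proof
    fix h assume "h \<in> {h. tree_like h}"
    then have s: "steps h" and "\<forall>v\<in>V. \<exists>k. (h ^^ k) v = base 0"
      unfolding tree_like_def by auto
    moreover have "tot (par h) (h (base 0)) = h"
      using s unfolding steps_def by (intro tot_par) blast
    ultimately show "(\<lambda>(E, x). tot (parent_map V E (base 0)) x) (?enc h) = h"
      by (simp add: parent_map_edges)
  qed
  have dec: "?enc (tot (parent_map V E (base 0)) x) = (E, x) \<and> tree_like (tot (parent_map V E (base 0)) x)"
    if T: "(E, x) \<in> ?T" for E x
  proof -
    let ?p = "parent_map V E (base 0)"
    let ?h = "tot ?p x"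
    have tree: "is_tree V E" and root: "base 0 \<in> V" and x: "x \<in> V" "fst x = r"
      and step: "\<And>v w. ?p v = Some w \<Longrightarrow> w \<in> (\<Union>s\<in>S. layer n r (abscissa v - s))"
      using T unfolding marked_S_tree_def S_tree_def base0 by (auto simp: layer_def abscissa_def)
    have dom: "dom ?p = V - {base 0}"
      by (auto simp: parent_map_def dom_def)
    have s: "steps ?h"
      using steps_tot[OF dom x(1) step] .
    have "?h v = w" if "?p v = Some w" for v w
      using that dom unfolding tot_def by (auto simp: dom_def)
    then have rm: "rooted_map V (base 0) ?h" and E: "map_edges V (base 0) ?h = E"
      using tree_parent_rooted_map[OF tree root] by blast+
    have hx: "?h (base 0) = x" by (simp add: tot_def)
    have "\<forall>i\<in>{1..r}. passage ?h i x \<and> fst (?h (base i)) = i - 1"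
      using condition_T_iff[OF rm s x] T unfolding E by simp
    then have "tree_like ?h"
      using s x(2) rooted_map.reach[OF rm] unfolding tree_like_def hx by blast
    then show ?thesis
      using E hx by simp
  qed
  show "\<forall>T\<in>?T. ?enc ((\<lambda>(E, x). tot (parent_map V E (base 0)) x) T) = T"
  proof
    fix T assume "T \<in> ?T"
    then show "?enc ((\<lambda>(E, x). tot (parent_map V E (base 0)) x) T) = T"
      using dec[of "fst T" "snd T"] by (simp add: case_prod_unfold)
  qed
  show "(\<lambda>(E, x). tot (parent_map V E (base 0)) x) ` ?T \<subseteq> {h. tree_like h}"
  proof (rule image_subsetI)
    fix T assume "T \<in> ?T"
    then show "(\<lambda>(E, x). tot (parent_map V E (base 0)) x) T \<in> {h. tree_like h}"
      using dec[of "fst T" "snd T"] by (simp add: case_prod_unfold)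
  qed
  show "?enc ` {h. tree_like h} \<subseteq> ?T"
  proof (rule image_subsetI)
    fix h assume "h \<in> {h. tree_like h}"
    then have h: "tree_like h" by simp
    then have s: "steps h" and reach: "\<forall>v\<in>V. \<exists>k. (h ^^ k) v = base 0"
      and x: "fst (h (base 0)) = r"
      and pass: "\<forall>i\<in>{1..r}. passage h i (h (base 0)) \<and> fst (h (base i)) = i - 1"
      unfolding tree_like_def by auto
    have xV: "h (base 0) \<in> V"
      using s base_in_V[of 0] unfolding steps_def by simp
    have rm: "rooted_map V (base 0) h"
      using steps_rooted_map[OF s reach] .
    have "S_tree n r S (base 0) (map_edges V (base 0) h)"
      unfolding S_tree_def parent_map_edges[OF s reach]
      using rooted_map.map_edges_is_tree[OF rm] base_in_V[of 0] par_S_function(1)[OF s]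
      unfolding S_function_def by simp
    moreover have "h (base 0) \<in> layer n r (int r)"
      using x xV unfolding layer_def abscissa_def by simp
    moreover have "condition_T n r (0, 1) (?enc h)"
      using condition_T_iff[OF rm s xV x] pass by simp
    ultimately show "?enc h \<in> ?T"
      unfolding marked_S_tree_def base0 by simp
  qed
qed

subsection \<open>Types\<close>

lemma in_degrees_par:
  "in_degrees m (par h) v =
    map (\<lambda>k. card {u \<in> V - {base 0}. h u = v \<and> abscissa u = abscissa v + k}) [m..1]"
proof -
  have "{u. par h u = Some v \<and> abscissa u = abscissa v + k}
      = {u \<in> V - {base 0}. h u = v \<and> abscissa u = abscissa v + k}" for k
    unfolding par_def by auto
  then show ?thesis
    unfolding in_degrees_def by simp
qed

context
  fixes h :: "vertex \<Rightarrow> vertex" and \<nu> :: "nat \<Rightarrow> vertex \<Rightarrow> vertex"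
  assumes K: "admissible h" and \<nu>: "\<And>i. i \<le> r \<Longrightarrow> \<nu> i permutes entries h i"
begin

lemma out_step_act: "out_step (par (act h \<nu>)) v = out_step (par h) v"
  using fst_act[OF K \<nu>] unfolding out_step_def par_def abscissa_def by simp

text \<open>Here every arc is redirected, so the preimages of \<open>redirect h \<nu> v\<close>
  under the new map are those of \<open>v\<close> under \<open>h\<close>. This level-preserving
  permutation of the vertices therefore transports in-types.\<close>

lemma card_in_type_act:
  assumes "0 \<in> S"
  shows "card {v \<in> V. in_type m (par (act h \<nu>)) v = t} = card {v \<in> V. in_type m (par h) v = t}"
proof -
  let ?\<pi> = "redirect h \<nu>"
  have perm: "?\<pi> permutes V"
    using redirect_permutes[OF K \<nu>] by simp
  have act: "act h \<nu> u = ?\<pi> (h u)" for u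
    using assms unfolding act_def rerouted_def by simp
  have abs: "abscissa (?\<pi> v) = abscissa v" for v
    using fst_redirect[OF K \<nu>] unfolding abscissa_def by simp
  have "act h \<nu> u = ?\<pi> v \<longleftrightarrow> h u = v" for u v
    unfolding act using permutes_inj[OF perm] by (simp add: inj_eq)
  then have type: "in_type m (par (act h \<nu>)) (?\<pi> v) = in_type m (par h) v" for v
    unfolding in_type_def in_degrees_par abs by simp
  have "{v \<in> V. in_type m (par (act h \<nu>)) v = t}
      = {v \<in> ?\<pi> ` V. in_type m (par (act h \<nu>)) v = t}"
    unfolding permutes_image[OF perm] ..
  also have "\<dots> = ?\<pi> ` {v \<in> V. in_type m (par h) v = t}"
    by (simp only: Compr_image_eq type)
  finally show ?thesis
    using permutes_inj_on[OF perm] by (simp add: card_image)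
qed

end

text \<open>An entry has one predecessor on its cycle of \<open>cut h i\<close>, hence is the head
  of one rerouted arc, with \<open>src i\<close> in place of the tail \<open>base i\<close>. As
  level steps are at most 1 and not 0, the tail is on level \<open>i + 1\<close>; for
  \<open>i = r\<close> it is \<open>base 0\<close>, which is not counted. The number thus does not
  depend on the map.\<close>

lemma card_core_predecessors:
  assumes K: "admissible h" and S: "0 \<notin> S" and w: "w \<in> entries h i"
  shows "card {u \<in> V - {base 0}. u \<in> rerouted h \<and> h u = w \<and> abscissa u = abscissa w + k}
    = (if k = 1 \<and> i < r then 1 else 0)"
proof -
  have i: "i \<le> r" and fw: "fst w = i" and wC: "w \<in> core h i"
    using entries_D[OF w] entries_subset_core w by blast+
  have A: "rerouted h = (\<Union>i\<le>r. core h i)"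
    using S unfolding rerouted_def by simp
  \<comment> \<open>A rerouted tail \<open>base j\<close> is \<open>src l\<close> for some
    \<open>l\<close>, and its head is an entry of level \<open>l\<close>; any other tail in
    \<open>core h j\<close> has its head in the same core. The head \<open>w\<close> forces
    \<open>l = i\<close> or \<open>j = i\<close>.\<close>
  have cases: "u \<in> core h i \<and> u \<noteq> base i \<or> u = src i" if u: "u \<in> rerouted h" "h u = w" for u
  proof -
    obtain j where j: "j \<le> r" "u \<in> core h j"
      using u(1) unfolding A by blast
    show ?thesis
    proof (cases "u = base j")
      case True
      have "\<exists>l\<le>r. u = src l"
      proof (cases "j = 0")
        case True
        then show ?thesis
          using \<open>u = base j\<close> by (intro exI[of _ r]) (simp add: src_def)
      next
        case False
        then show ?thesis
          using \<open>u = base j\<close> j(1) src_less[of j] by (intro exI[of _ "j - 1"]) simp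
      qed
      then obtain l where l: "l \<le> r" "u = src l" by blast
      then have "w \<in> entries h l"
        using h_src_in_entries[OF K l(1)] u(2) by simp
      then have "l = i" using entries_D(2) fw by blast
      then show ?thesis using l by simp
    next
      case False
      then have "w \<in> core h j"
        using core_closed[OF j(2)] cut_other[OF False] u(2) by simp
      then have "j = i" using core_disjoint[OF K wC] by blast
      then show ?thesis using False j(2) by simp
    qed
  qed
  have base: "base i \<in> core h i"
    using base_in_core[OF K i] .
  have unique: "u = u'" if "u \<in> rerouted h" "h u = w" "u' \<in> rerouted h" "h u' = w" for u u'
  proof -
    \<comment> \<open>Replacing \<open>src i\<close> by \<open>base i\<close> turns the rerouted
      arcs into \<open>w\<close> into arcs of \<open>cut h i\<close> inside \<open>core h i\<close>,
      where injectivity applies.\<close>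
    define c where "c u = (if u \<in> core h i \<and> u \<noteq> base i then u else base i)" for u
    have c: "c u \<in> core h i \<and> cut h i (c u) = w" if "u \<in> rerouted h" "h u = w" for u
      using cases[OF that] that(2) base unfolding c_def by (auto simp: cut_other cut_base)
    have "c u = c u'"
      by (rule inj_onD[OF cut_inj_on_core, of h i]) (use c[OF that(1,2)] c[OF that(3,4)] in simp_all)
    then show ?thesis
      using cases[of u] cases[of u'] that unfolding c_def by (auto split: if_splits)
  qed
  have "\<exists>u\<in>rerouted h. h u = w"
  proof -
    obtain k where k: "0 < k" "(cut h i ^^ k) w = w"
      using entries_D(4)[OF w] unfolding periodic_def by blast
    then obtain l where l: "k = Suc l" using gr0_conv_Suc by auto
    define z where "z = (cut h i ^^ l) w"
    have z: "z \<in> core h i"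
      unfolding z_def using w unfolding core_def by blast
    have cz: "cut h i z = w"
      using k(2) l unfolding z_def by simp
    show ?thesis
    proof (cases "z = base i")
      case True
      have "src i \<in> rerouted h"
        using base_in_core[OF K, of 0] base_in_core[OF K, of "Suc i"] i core_subset_rerouted
        unfolding src_def by (cases "i = r") auto
      then show ?thesis
        using cz True by (intro bexI[of _ "src i"]) (auto simp: cut_base)
    next
      case False
      then show ?thesis
        using cz z core_subset_rerouted cut_other[OF False, of h] by auto
    qed
  qed
  then obtain u where u: "u \<in> rerouted h" "h u = w" by blast
  have uV: "u \<in> V"
    using cases[OF u] core_subset_V[OF K] src_in_V[OF i] by blast
  have lev: "i < r \<and> fst u = Suc i" if "u \<noteq> base 0"
  proof (cases "u = src i")
    case True
    then show ?thesis
      using that i unfolding src_def by (auto split: if_splits)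
  next
    case False
    then have "u \<in> core h i" using cases[OF u] by blast
    then have "i \<le> fst u" by (rule core_level)
    moreover have "int (fst u) - int i \<in> S"
      using admissible_D(3)[OF K uV that] u(2) fw by simp
    then have "int (fst u) - int i \<le> 1" "int (fst u) - int i \<noteq> 0"
      using S_le_1 S by auto
    ultimately show ?thesis
      using fst_le[OF uV] by auto
  qed
  have ne: "u \<noteq> base 0" if "i < r"
    using cases[OF u] that core_level[of u h i] unfolding src_def by auto
  have "{u' \<in> V - {base 0}. u' \<in> rerouted h \<and> h u' = w \<and> abscissa u' = abscissa w + k}
      = (if k = 1 \<and> i < r then {u} else {})"
    (is "?P = _")
  proof (cases "k = 1 \<and> i < r")
    case True
    then have "u \<in> ?P"
      using u uV ne lev fw unfolding abscissa_def by simp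
    moreover have "?P \<subseteq> {u}"
      using unique[OF _ _ u] by blast
    ultimately show ?thesis
      using True by auto
  next
    case False
    have "u' \<notin> ?P" for u'
    proof
      assume u': "u' \<in> ?P"
      then have "u' = u"
        using unique[OF _ _ u] by blast
      then have "i < r" "fst u = Suc i" "int (fst u) = int i + k"
        using lev u' fw unfolding abscissa_def by auto
      then show False using False by simp
    qed
    then show ?thesis using False by auto
  qed
  then show ?thesis by simp
qed

text \<open>Vertices that are not entries keep all their incoming arcs. An entry keeps those that
  are not rerouted, and the number of rerouted ones is given by
  \<open>card_core_predecessors\<close> before and after.\<close>

lemma in_degrees_act:
  assumes K: "admissible h" and \<nu>: "\<And>i. i \<le> r \<Longrightarrow> \<nu> i permutes entries h i" and S: "0 \<notin> S"
  shows "in_degrees m (par (act h \<nu>)) w = in_degrees m (par h) w"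
proof -
  let ?g = "act h \<nu>"
  have "card {u \<in> V - {base 0}. ?g u = w \<and> abscissa u = abscissa w + k}
      = card {u \<in> V - {base 0}. h u = w \<and> abscissa u = abscissa w + k}" for k
  proof (cases "w \<in> entries h (fst w)")
    case True
    have Ag: "rerouted ?g = rerouted h"
      using rerouted_act[OF K \<nu>] by simp
    have split: "card {u \<in> V - {base 0}. f u = w \<and> abscissa u = abscissa w + k}
        = card {u \<in> V - {base 0}. u \<in> rerouted h \<and> f u = w \<and> abscissa u = abscissa w + k}
        + card {u \<in> V - {base 0}. u \<notin> rerouted h \<and> f u = w \<and> abscissa u = abscissa w + k}" for f
      using finite_V by (subst card_Un_disjoint[symmetric]) (auto intro!: arg_cong[of _ _ card])
    have "w \<in> entries ?g (fst w)"
      using True entries_act[OF K \<nu> entries_D(3)[OF True]] by simp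
    moreover have "admissible ?g"
      using admissible_act[OF K \<nu>] by simp
    ultimately have "card {u \<in> V - {base 0}. u \<in> rerouted h \<and> ?g u = w \<and> abscissa u = abscissa w + k}
        = card {u \<in> V - {base 0}. u \<in> rerouted h \<and> h u = w \<and> abscissa u = abscissa w + k}"
      using card_core_predecessors[OF _ S, of ?g w "fst w" k]
        card_core_predecessors[OF K S True, of k] Ag by simp
    moreover have "?g u = h u" if "u \<notin> rerouted h" for u
      using that unfolding act_def by simp
    then have "{u \<in> V - {base 0}. u \<notin> rerouted h \<and> ?g u = w \<and> abscissa u = abscissa w + k}
        = {u \<in> V - {base 0}. u \<notin> rerouted h \<and> h u = w \<and> abscissa u = abscissa w + k}"
      by auto
    ultimately show ?thesis
      unfolding split by simp
  next
    case False
    have "redirect h \<nu> x = w \<longleftrightarrow> x = w" for x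
    proof (cases "x \<in> entries h (fst x)")
      case True
      then have "redirect h \<nu> x \<in> entries h (fst x)"
        using redirect_in_entries[OF K \<nu>] by simp
      then show ?thesis
        using True False entries_D(2) by metis
    next
      case False
      then show ?thesis
        unfolding redirect_def by simp
    qed
    then have "?g u = w \<longleftrightarrow> h u = w" for u
      unfolding act_def by simp
    then show ?thesis by simp
  qed
  then show ?thesis
    unfolding in_degrees_par by simp
qed

end

section \<open>Assembling the bijection\<close>

theorem theorem3p1:
  fixes n :: "nat \<Rightarrow> nat" and r :: nat and S :: "int set" and m :: int
  assumes n_pos: "\<And>i. i \<le> r \<Longrightarrow> 0 < n i"
    and min_S: "m \<in> S" "\<And>s. s \<in> S \<Longrightarrow> m \<le> s"
    and max_S: "1 \<in> S" "\<And>s. s \<in> S \<Longrightarrow> s \<le> 1"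
  shows "\<exists>\<Phi> :: (vertex \<rightharpoonup> vertex) \<Rightarrow> vertex set set \<times> vertex.
    bij_betw \<Phi>
      {f. S_function n r S f \<and> dom f = vertices n r - {(0, 1)} \<and> condition_F r f}
      {T. marked_S_tree n r S (0, 1) T \<and> condition_T n r (0, 1) T} \<and>
    (\<forall>f E x.
       S_function n r S f \<and> dom f = vertices n r - {(0, 1)} \<and> condition_F r f \<and>
       \<Phi> f = (E, x) \<longrightarrow>
       (let g = parent_map (vertices n r) E (0, 1) in
         (\<forall>v \<in> vertices n r. out_type g v = out_type f v) \<and>
         (\<forall>i c. card {v \<in> vertices n r. in_type m g v = (i, c)} =
                card {v \<in> vertices n r. in_type m f v = (i, c)}) \<and>
         (0 \<notin> S \<longrightarrow> (\<forall>v \<in> vertices n r. vertex_type m g v = vertex_type m f v))))"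
proof -
  interpret layered n r S
    using n_pos max_S(2) by unfold_locales
  have base0: "(0, 1) = base 0" by (simp add: base_def)
  let ?F = "{f. S_function n r S f \<and> dom f = V - {base 0} \<and> condition_F r f}"
  let ?T = "{T. marked_S_tree n r S (0, 1) T \<and> condition_T n r (0, 1) T}"
  let ?tot = "\<lambda>f. tot f (base r)"
  obtain \<nu> where bij: "bij_betw (\<lambda>h. act h (\<nu> h)) {h. fixing h} {h. cyclic h}"
    and \<nu>: "\<And>h i. fixing h \<Longrightarrow> i \<le> r \<Longrightarrow> \<nu> h i permutes entries h i"
    using ex_bij_fixing_cyclic by blast
  let ?enc = "\<lambda>h. (map_edges V (base 0) h, h (base 0))"
  \<comment> \<open>Close up the function, make its return maps cyclic, then read off the tree and
    its marked vertex.\<close>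
  define \<Phi> where "\<Phi> = ?enc \<circ> ((\<lambda>h. act h (\<nu> h)) \<circ> ?tot)"
  have "bij_betw \<Phi> ?F ?T"
    unfolding \<Phi>_def
    using bij_betw_trans[OF bij_betw_trans[OF bij_tot bij]] bij_encode
    unfolding cyclic_iff_tree_like by blast
  moreover have "(\<forall>v\<in>V. out_type g v = out_type f v) \<and>
      (\<forall>i c. card {v \<in> V. in_type m g v = (i, c)} = card {v \<in> V. in_type m f v = (i, c)}) \<and>
      (0 \<notin> S \<longrightarrow> (\<forall>v\<in>V. vertex_type m g v = vertex_type m f v))"
    if f: "f \<in> ?F" and \<Phi>f: "\<Phi> f = (E, x)" and g: "g = parent_map V E (base 0)" for f E x g
  proof -
    define h where "h = ?tot f"
    have FK: "fixing h"
      using bij_betw_apply[OF bij_tot f] unfolding h_def by simp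
    then have K: "admissible h" by (simp add: fixing_def)
    have \<nu>h: "\<nu> h i permutes entries h i" if "i \<le> r" for i
      using \<nu>[OF FK that] .
    have "tree_like (act h (\<nu> h))"
      using bij_betw_apply[OF bij, of h] FK unfolding cyclic_iff_tree_like by simp
    moreover have "E = map_edges V (base 0) (act h (\<nu> h))"
      using \<Phi>f unfolding \<Phi>_def h_def by simp
    ultimately have g': "g = par (act h (\<nu> h))"
      using parent_map_edges unfolding g tree_like_def by simp
    have f': "f = par h"
      using par_tot f unfolding h_def by simp
    have out: "out_step g v = out_step f v" for v
      unfolding g' f' using out_step_act[OF K \<nu>h] .
    have "in_degrees m g v = in_degrees m f v" if "0 \<notin> S" for v
      unfolding g' f' using in_degrees_act[OF K \<nu>h that] .
    moreover have "card {v \<in> V. in_type m g v = t} = card {v \<in> V. in_type m f v = t}" if "0 \<in> S" for t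
      unfolding g' f' using card_in_type_act[OF K \<nu>h that] .
    \<comment> \<open>If \<open>0 \<notin> S\<close>, in-types agree vertex by vertex, which also
      gives the count in (b); otherwise the count comes from
      \<open>card_in_type_act\<close>.\<close>
    ultimately show ?thesis
      using out unfolding out_type_def vertex_type_def
      by (cases "0 \<in> S") (simp_all add: in_type_def[of m g] in_type_def[of m f] del: prod.inject)
  qed
  ultimately show ?thesis
    unfolding base0 Let_def by (intro exI[of _ \<Phi>]) simp
qed

end
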